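(* Let $P=(\Sigma,R)$ be a TSS in the tyft/tyxt format with recursion. Then bisimilarity $\equiv_B$ is a full congruence, i.e. it is an equivalence relation on $\mathrm{T}(\Sigma)$ satisfying: (1) for every $(f,n)\in\Sigma$ and closed terms $p_i,q_i$ with $p_i\equiv_B q_i$ for $i=1,\dots,n$, $f(p_1,\dots,p_n)\equiv_B f(q_1,\dots,q_n)$; and (2) for all $W\subseteq\mathrm{Var}$, $X\in W$, and recursive specifications $S,S':W\to\mathbb{T}(\Sigma,W)$, if $S_Y[\sigma]\equiv_B S'_Y[\sigma]$ for all $Y\in W$ and all $\sigma:W\to\mathrm{T}(\Sigma)$, then $\langle X|S\rangle\equiv_B\langle X|S'\rangle$.
   Context: Terms with recursion $\mathbb{T}(\Sigma)$ over $\Sigma$: variables, $f(t_1,\dots,t_n)$ for $(f,n)\in\Sigma$, and $\langle X|S\rangle$ for $S:V_S\to\mathbb{T}(\Sigma)$, $V_S\subseteq\mathrm{Var}$, $X\in V_S$ (binding $V_S$). $\mathbb{T}(\Sigma,W)$ = terms whose free variables lie in $W$; $\mathrm{T}(\Sigma)$ = closed terms. $t[\sigma]$ is capture-avoiding substitution of free variables. Literals $t\xrightarrow{a}t'$; rules $\frac{H}{\alpha}$ with $H$ a set of positive literals; TSS $P=(\Sigma,R)$; $P\vdash p\xrightarrow{a}q$ for closed $p,q$ means there is a well-founded proof tree with root $p\xrightarrow{a}q$ in which each node with children labels $K$ and label $\beta$ has $\frac{K}{\beta}$ a substitution instance of a rule in $R$. A bisimulation is a symmetric relation $\mathcal{R}\subseteq\mathrm{T}(\Sigma)\times\mathrm{T}(\Sigma)$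 such that $p\mathcal{R}q$ and $P\vdash p\xrightarrow{a}p'$ imply some $q'$ with $P\vdash q\xrightarrow{a}q'$ and $p'\mathcal{R}q'$; $p\equiv_B q$ iff some bisimulation relates them. tyft/tyxt format with recursion: for every recursive specification $S$, $X\in V_S$, $a\in A$ the TSS contains the rule $\frac{\langle S_X|S\rangle\xrightarrow{a}z}{\langle X|S\rangle\xrightarrow{a}z}$ where $\langle t|S\rangle$ abbreviates $t[\langle Y|S\rangle/Y]_{Y\in V_S}$; all other rules have only positive premises whose right-hand sides are distinct variables not occurring in the source, and the source is either a variable (tyxt) or contains exactly one function symbol and no repeated variables (tyft). *)

theory Defs
  imports Main
begin

text \<open>Terms over function symbols 'f and variables 'v.  A recursive
specification S : V_S -> terms is a partial map 'v => term option with
domain V_S; Rec X S is the term <X|S>.\<close>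

datatype ('f, 'v) trm =
    Var 'v
  | Fun 'f "('f, 'v) trm list"
  | Rec 'v "'v \<Rightarrow> ('f, 'v) trm option"

primrec fv :: "('f, 'v) trm \<Rightarrow> 'v set" where
  "fv (Var x) = {x}"
| "fv (Fun f ts) = \<Union> (set (map fv ts))"
| "fv (Rec X S) = (\<Union>Y. case map_option fv (S Y) of None \<Rightarrow> {} | Some A \<Rightarrow> A) - dom S"

primrec wf_trm :: "('f \<times> nat) set \<Rightarrow> ('f, 'v) trm \<Rightarrow> bool" where
  "wf_trm \<Sigma> (Var x) = True"
| "wf_trm \<Sigma> (Fun f ts) = ((f, length ts) \<in> \<Sigma> \<and> list_all (wf_trm \<Sigma>) ts)"
| "wf_trm \<Sigma> (Rec X S) = (X \<in> dom S \<and> (\<forall>Y. pred_option (\<lambda>b. b) (map_option (wf_trm \<Sigma>) (S Y))))"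

text \<open>Simultaneous substitution; bound variables are protected.  It is
capture-avoiding whenever the substituted terms are closed, which is the
only way it is used below.\<close>
primrec subst :: "('f, 'v) trm \<Rightarrow> ('v \<Rightarrow> ('f, 'v) trm) \<Rightarrow> ('f, 'v) trm" where
  "subst (Var x) \<sigma> = \<sigma> x"
| "subst (Fun f ts) \<sigma> = Fun f (map (\<lambda>t. subst t \<sigma>) ts)"
| "subst (Rec X S) \<sigma> =
     Rec X (\<lambda>Y. map_option (\<lambda>t. subst t (\<lambda>v. if v \<in> dom S then Var v else \<sigma> v)) (S Y))"

definition closed_trms :: "('f \<times> nat) set \<Rightarrow> ('f, 'v) trm set" where
  "closed_trms \<Sigma> = {t. wf_trm \<Sigma> t \<and> fv t = {}}"

definition trms_over :: "('f \<times> nat) set \<Rightarrow> 'v set \<Rightarrow> ('f, 'v) trm set" where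
  "trms_over \<Sigma> W = {t. wf_trm \<Sigma> t \<and> fv t \<subseteq> W}"

type_synonym ('f, 'v, 'a) lit = "('f, 'v) trm \<times> 'a \<times> ('f, 'v) trm"
type_synonym ('f, 'v, 'a) rule = "('f, 'v, 'a) lit set \<times> ('f, 'v, 'a) lit"

definition tyft_tyxt_rule :: "('f \<times> nat) set \<Rightarrow> ('f, 'v, 'a) rule \<Rightarrow> bool" where
  "tyft_tyxt_rule \<Sigma> r \<longleftrightarrow>
     (case r of (H, (s, a, t)) \<Rightarrow>
        wf_trm \<Sigma> s \<and> wf_trm \<Sigma> t
      \<and> (\<forall>(u, b, v) \<in> H. wf_trm \<Sigma> u \<and> (\<exists>y. v = Var y \<and> y \<notin> fv s))
      \<and> (\<forall>h1 \<in> H. \<forall>h2 \<in> H. snd (snd h1) = snd (snd h2) \<longrightarrow> h1 = h2)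
      \<and> ((\<exists>x. s = Var x)
         \<or> (\<exists>f xs. s = Fun f (map Var xs) \<and> distinct xs)))"

inductive proves :: "('f \<times> nat) set \<Rightarrow> ('f, 'v, 'a) rule set \<Rightarrow>
    ('f, 'v) trm \<Rightarrow> 'a \<Rightarrow> ('f, 'v) trm \<Rightarrow> bool"
  for \<Sigma> :: "('f \<times> nat) set" and R :: "('f, 'v, 'a) rule set" where
  rule: "\<lbrakk> (H, (s, a, t)) \<in> R;
           \<And>v. \<sigma> v \<in> closed_trms \<Sigma>;
           \<And>u b w. (u, b, w) \<in> H \<Longrightarrow> proves \<Sigma> R (subst u \<sigma>) b (subst w \<sigma>) \<rbrakk>
         \<Longrightarrow> proves \<Sigma> R (subst s \<sigma>) a (subst t \<sigma>)"
| recursion: "\<lbrakk> Rec X S \<in> closed_trms \<Sigma>;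
           proves \<Sigma> R (subst (the (S X)) (\<lambda>Y. if Y \<in> dom S then Rec Y S else Var Y)) a q \<rbrakk>
         \<Longrightarrow> proves \<Sigma> R (Rec X S) a q"

definition bisimulation :: "('f \<times> nat) set \<Rightarrow> ('f, 'v, 'a) rule set \<Rightarrow>
    (('f, 'v) trm \<times> ('f, 'v) trm) set \<Rightarrow> bool" where
  "bisimulation \<Sigma> R \<R> \<longleftrightarrow>
     \<R> \<subseteq> closed_trms \<Sigma> \<times> closed_trms \<Sigma> \<and> sym \<R> \<and>
     (\<forall>p q a p'. (p, q) \<in> \<R> \<and> proves \<Sigma> R p a p' \<longrightarrow>
        (\<exists>q'. proves \<Sigma> R q a q' \<and> (p', q') \<in> \<R>))"

definition bisimilar :: "('f \<times> nat) set \<Rightarrow> ('f, 'v, 'a) rule set \<Rightarrow>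
    ('f, 'v) trm \<Rightarrow> ('f, 'v) trm \<Rightarrow> bool" where
  "bisimilar \<Sigma> R p q \<longleftrightarrow> (\<exists>\<R>. bisimulation \<Sigma> R \<R> \<and> (p, q) \<in> \<R>)"

end

theory Submission
  imports Defs
begin

text \<open>
  The premises of a rule may depend on each other cyclically, so a transition of \<open>p\<close> cannot be
  transferred to a related \<open>q\<close> by choosing the values of the premise variables one after the other.
  Instead, \<open>q\<close> is described by a marking of \<open>p\<close> that says which closed subterms of \<open>p\<close> are replaced
  and by what. Markings are partial maps from positions to labels; an undefined label means that
  nothing is known yet and that the subterm stays as it is. Along a proof of \<open>p \<longrightarrow> p'\<close>,
  a marking of \<open>p\<close> is transformed monotonically into a marking of \<open>p'\<close>, so the values of
  the premise variables of a rule can be taken as a least fixed point, even when they are cyclic.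
  Where the fixed point stays undefined both sides coincide, and the original proof is reused.

  Taking bisimilarity as the relation between replaced and replacing subterms shows that bisimilarity
  is preserved by all contexts, including those under a recursion binder. For recursive
  specifications \<open>S\<close> and \<open>S'\<close> one takes the contextual closure of the pairs
  \<open>\<langle>Y|S\<rangle>\<close>, \<open>\<langle>Y|S'\<rangle>\<close>, followed by bisimilarity.
\<close>

section \<open>Terms and substitution\<close>

text \<open>The datatype's own rule reaches the bodies of a specification through
  \<open>range S\<close> and the option type; here the induction hypothesis speaks of the bodies
  directly.\<close>

lemma trm_induct [case_names Var Fun Rec]:
  assumes "\<And>x. P (Var x)"
    and "\<And>f ts. (\<And>t. t \<in> set ts \<Longrightarrow> P t) \<Longrightarrow> P (Fun f ts)"
    and "\<And>X S. (\<And>Y t. S Y = Some t \<Longrightarrow> P t) \<Longrightarrow> P (Rec X S)"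
  shows "P t"
proof (induction t)
  case (Rec X S)
  have "P t" if "S Y = Some t" for Y t
    using Rec[of "S Y" t] that by (metis option.set_intros rangeI)
  then show ?case using assms(3) by blast
qed (use assms in auto)

lemma fv_Rec: "fv (Rec X S) = (\<Union>t \<in> ran S. fv t) - dom S"
proof -
  have "(\<Union>Y. case map_option fv (S Y) of None \<Rightarrow> {} | Some A \<Rightarrow> A) = (\<Union>t \<in> ran S. fv t)"
    by (force simp: ran_def split: option.splits)
  then show ?thesis by simp
qed

lemma wf_trm_Rec: "wf_trm \<Sigma> (Rec X S) \<longleftrightarrow> X \<in> dom S \<and> (\<forall>t \<in> ran S. wf_trm \<Sigma> t)"
proof -
  have "pred_option (\<lambda>b. b) (map_option (wf_trm \<Sigma>) (S Y)) \<longleftrightarrow> (\<forall>t. S Y = Some t \<longrightarrow> wf_trm \<Sigma> t)" for Y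
    by (cases "S Y") auto
  then show ?thesis by (auto simp: ran_def)
qed

declare fv.simps(3) [simp del] wf_trm.simps(3) [simp del]

lemma subst_cong: "(\<And>v. v \<in> fv t \<Longrightarrow> \<sigma> v = \<tau> v) \<Longrightarrow> subst t \<sigma> = subst t \<tau>"
proof (induction t arbitrary: \<sigma> \<tau> rule: trm_induct)
  case (Fun f ts)
  have "subst t \<sigma> = subst t \<tau>" if "t \<in> set ts" for t
    by (rule Fun.IH[OF that], rule Fun.prems) (use that in auto)
  then show ?case by simp
next
  case (Rec X S)
  have "subst t (\<lambda>v. if v \<in> dom S then Var v else \<sigma> v) = subst t (\<lambda>v. if v \<in> dom S then Var v else \<tau> v)"
    if "S Y = Some t" for Y t
  proof (rule Rec.IH[OF that])
    fix v assume "v \<in> fv t"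
    then have "v \<in> fv (Rec X S)" if "v \<notin> dom S"
      using that \<open>S Y = Some t\<close> unfolding fv_Rec ran_def by blast
    then show "(if v \<in> dom S then Var v else \<sigma> v) = (if v \<in> dom S then Var v else \<tau> v)"
      using Rec.prems by metis
  qed
  then have "map_option (\<lambda>t. subst t (\<lambda>v. if v \<in> dom S then Var v else \<sigma> v)) (S Y)
      = map_option (\<lambda>t. subst t (\<lambda>v. if v \<in> dom S then Var v else \<tau> v)) (S Y)" for Y
    by (cases "S Y") (simp_all only: option.map)
  then show ?case by (simp only: subst.simps)
qed simp

lemma subst_Var: "subst t Var = t"
proof (induction t rule: trm_induct)
  case (Fun f ts)
  then show ?case by (simp add: map_idI)
next
  case (Rec X S)
  then have "map_option (\<lambda>t. subst t Var) (S Y) = S Y" for Y by (cases "S Y") auto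
  then show ?case by simp
qed simp

lemma subst_closed: "fv t = {} \<Longrightarrow> subst t \<sigma> = t"
  using subst_cong[of t \<sigma> Var] subst_Var[of t] by simp

lemma fv_subst: "fv (subst t \<sigma>) \<subseteq> (\<Union>v \<in> fv t. fv (\<sigma> v))"
proof (induction t arbitrary: \<sigma> rule: trm_induct)
  case (Rec X S)
  show ?case
  proof
    fix x assume x: "x \<in> fv (subst (Rec X S) \<sigma>)"
    let ?\<sigma> = "\<lambda>v. if v \<in> dom S then Var v else \<sigma> v"
    from x obtain Y t where Y: "S Y = Some t" "x \<in> fv (subst t ?\<sigma>)" "x \<notin> dom S"
      by (auto simp: fv_Rec ran_def dom_def)
    from Rec.IH[OF Y(1), of ?\<sigma>] Y(2) obtain v where v: "v \<in> fv t" "x \<in> fv (?\<sigma> v)" by blast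
    with Y(3) have "v \<notin> dom S" by (auto split: if_splits)
    with v Y(1) show "x \<in> (\<Union>v \<in> fv (Rec X S). fv (\<sigma> v))"
      by (auto simp: fv_Rec ran_def)
  qed
qed fastforce+

lemma wf_trm_subst: "wf_trm \<Sigma> t \<Longrightarrow> (\<And>v. v \<in> fv t \<Longrightarrow> wf_trm \<Sigma> (\<sigma> v)) \<Longrightarrow> wf_trm \<Sigma> (subst t \<sigma>)"
proof (induction t arbitrary: \<sigma> rule: trm_induct)
  case (Fun f ts)
  then show ?case by (auto simp: list_all_iff)
next
  case (Rec X S)
  have "wf_trm \<Sigma> (subst t (\<lambda>v. if v \<in> dom S then Var v else \<sigma> v))" if "S Y = Some t" for Y t
    by (rule Rec.IH[OF that]) (use that Rec.prems in \<open>auto simp: wf_trm_Rec fv_Rec ran_def\<close>)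
  with Rec.prems(1) show ?case by (auto simp: wf_trm_Rec ran_def dom_def)
qed auto

lemma subst_closed_trms:
  assumes "wf_trm \<Sigma> t" "\<And>v. v \<in> fv t \<Longrightarrow> \<sigma> v \<in> closed_trms \<Sigma>"
  shows "subst t \<sigma> \<in> closed_trms \<Sigma>"
  using wf_trm_subst[of \<Sigma> t \<sigma>] fv_subst[of t \<sigma>] assms unfolding closed_trms_def by fastforce

section \<open>Markings\<close>

text \<open>\<open>Open\<close> and an undefined label both keep the node, but \<open>Open\<close>
  is definite: extending a partial map may turn an undefined label into a mark, never an
  \<open>Open\<close> one.\<close>

datatype ('f, 'v) lab = Open | Mark "('f, 'v) trm"

type_synonym 'v pos = "('v + nat) list"
type_synonym ('f, 'v) marking = "'v pos \<rightharpoonup> ('f, 'v) lab"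

fun child :: "('f, 'v) trm \<Rightarrow> 'v + nat \<Rightarrow> ('f, 'v) trm option" where
  "child (Fun f ts) (Inr i) = (if i < length ts then Some (ts ! i) else None)"
| "child (Rec X S) (Inl Y) = S Y"
| "child _ _ = None"

primrec subat :: "('f, 'v) trm \<Rightarrow> 'v pos \<Rightarrow> ('f, 'v) trm option" where
  "subat t [] = Some t"
| "subat t (d # \<pi>) = Option.bind (child t d) (\<lambda>c. subat c \<pi>)"

abbreviation (input) below :: "('f, 'v) marking \<Rightarrow> 'v + nat \<Rightarrow> ('f, 'v) marking" where
  "below M d \<equiv> \<lambda>\<pi>. M (d # \<pi>)"

text \<open>Mapping \<open>decode\<close> over the list before indexing keeps the recursion
  primitive although every argument receives a marking of its own; \<open>graft\<close> uses the
  same device.\<close>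

primrec decode :: "('f, 'v) trm \<Rightarrow> ('f, 'v) marking \<Rightarrow> ('f, 'v) trm" where
  "decode (Var x) M = (case M [] of Some (Mark q) \<Rightarrow> q | _ \<Rightarrow> Var x)"
| "decode (Fun f ts) M = (case M [] of Some (Mark q) \<Rightarrow> q
     | _ \<Rightarrow> Fun f (map (\<lambda>i. (map decode ts ! i) (below M (Inr i))) [0..<length ts]))"
| "decode (Rec X S) M = (case M [] of Some (Mark q) \<Rightarrow> q
     | _ \<Rightarrow> Rec X (\<lambda>Y. map_option (\<lambda>t. decode t (below M (Inl Y))) (S Y)))"

lemma decode_Mark [simp]: "M [] = Some (Mark q) \<Longrightarrow> decode p M = q"
  by (cases p) auto

lemma decode_Var: "(\<And>q. M [] \<noteq> Some (Mark q)) \<Longrightarrow> decode (Var x) M = Var x"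
  by (cases "M []"; cases "the (M [])") simp_all

lemma decode_Fun: "(\<And>q. M [] \<noteq> Some (Mark q)) \<Longrightarrow>
    decode (Fun f ts) M = Fun f (map (\<lambda>i. decode (ts ! i) (below M (Inr i))) [0..<length ts])"
  by (cases "M []"; cases "the (M [])") simp_all

lemma decode_Rec: "(\<And>q. M [] \<noteq> Some (Mark q)) \<Longrightarrow>
    decode (Rec X S) M = Rec X (\<lambda>Y. map_option (\<lambda>t. decode t (below M (Inl Y))) (S Y))"
  by (cases "M []"; cases "the (M [])") simp_all

declare decode.simps [simp del]

lemma decode_empty [simp]: "decode p (\<lambda>\<pi>. None) = p"
proof (induction p rule: trm_induct)
  case (Fun f ts)
  have "map (\<lambda>i. decode (ts ! i) (\<lambda>\<pi>. None)) [0..<length ts] = ts"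
    by (rule nth_equalityI) (simp_all add: Fun)
  then show ?case by (simp add: decode_Fun)
next
  case (Rec X S)
  then have "map_option (\<lambda>t. decode t (\<lambda>\<pi>. None)) (S Y) = S Y" for Y by (cases "S Y") auto
  then show ?case by (simp add: decode_Rec)
qed (simp add: decode_Var)

text \<open>By the second condition all proper prefixes of a labelled position are
  \<open>Open\<close>. Hence nothing is labelled below a mark, and a marking with an undefined root
  is empty.\<close>

definition good :: "(('f, 'v) trm \<Rightarrow> ('f, 'v) trm \<Rightarrow> bool) \<Rightarrow> ('f, 'v) trm \<Rightarrow> ('f, 'v) marking \<Rightarrow> bool" where
  "good Q p M \<longleftrightarrow>
     (\<forall>\<pi> l. M \<pi> = Some l \<longrightarrow> (\<exists>r. subat p \<pi> = Some r \<and> (\<forall>q. l = Mark q \<longrightarrow> Q r q))) \<and>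
     (\<forall>\<pi> d. M (\<pi> @ [d]) \<noteq> None \<longrightarrow> M \<pi> = Some Open)"

lemma goodI:
  assumes "\<And>\<pi> l. M \<pi> = Some l \<Longrightarrow> \<exists>r. subat p \<pi> = Some r \<and> (\<forall>q. l = Mark q \<longrightarrow> Q r q)"
    and "\<And>\<pi> d. M (\<pi> @ [d]) \<noteq> None \<Longrightarrow> M \<pi> = Some Open"
  shows "good Q p M"
  unfolding good_def using assms by simp

lemma good_subat:
  assumes "good Q p M" "M \<pi> = Some l"
  obtains r where "subat p \<pi> = Some r" "\<And>q. l = Mark q \<Longrightarrow> Q r q"
  using assms(1)[unfolded good_def, THEN conjunct1, rule_format, OF assms(2)] by auto

lemma good_snoc: "good Q p M \<Longrightarrow> M (\<pi> @ [d]) \<noteq> None \<Longrightarrow> M \<pi> = Some Open"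
  unfolding good_def by (elim conjE allE impE)

text \<open>Monotonicity in \<open>Q\<close> admits \<open>good\<close> in the premises of an
  inductive definition; \<open>contextual\<close> depends on it.\<close>

lemma good_mono [mono]:
  assumes "\<And>p q. Q p q \<longrightarrow> Q' p q"
  shows "good Q p M \<longrightarrow> good Q' p M"
proof
  assume *: "good Q p M"
  show "good Q' p M"
  proof (rule goodI)
    fix \<pi> l assume "M \<pi> = Some l"
    with * show "\<exists>r. subat p \<pi> = Some r \<and> (\<forall>q. l = Mark q \<longrightarrow> Q' r q)"
      by (rule good_subat) (use assms in simp)
  qed (use good_snoc[OF *] in simp)
qed

lemma good_empty [simp]: "good Q p (\<lambda>\<pi>. None)"
  by (rule goodI) simp_all

lemma good_prefix: "good Q p M \<Longrightarrow> M (d # \<pi>) \<noteq> None \<Longrightarrow> M [] = Some Open"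
proof (induction \<pi> rule: rev_induct)
  case Nil
  then show ?case using good_snoc[of Q p M "[]" d] by simp
next
  case (snoc e \<pi>)
  then have "M (d # \<pi>) = Some Open" using good_snoc[of Q p M "d # \<pi>" e] by simp
  with snoc show ?case by simp
qed

lemma good_None:
  assumes "good Q p M" "M [] = None"
  shows "M = (\<lambda>\<pi>. None)"
proof
  fix \<pi> show "M \<pi> = None"
  proof (cases \<pi>)
    case (Cons d \<pi>')
    then show ?thesis using good_prefix[OF assms(1), of d \<pi>'] assms(2) by (cases "M \<pi>") simp_all
  qed (simp add: assms)
qed

lemma good_MarkD: "good Q p M \<Longrightarrow> M [] = Some (Mark q) \<Longrightarrow> Q p q"
  by (erule good_subat) auto

lemma good_Mark: "Q p q \<Longrightarrow> good Q p [[] \<mapsto> Mark q]"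
  by (rule goodI) (auto split: if_splits)

lemma good_below:
  assumes "good Q p M" "child p d = Some c"
  shows "good Q c (below M d)"
proof (rule goodI)
  fix \<pi> l assume "M (d # \<pi>) = Some l"
  with assms(1) show "\<exists>r. subat c \<pi> = Some r \<and> (\<forall>q. l = Mark q \<longrightarrow> Q r q)"
    by (rule good_subat) (use assms(2) in simp)
next
  fix \<pi> e assume "M (d # \<pi> @ [e]) \<noteq> None"
  then show "M (d # \<pi>) = Some Open" using good_snoc[OF assms(1), of "d # \<pi>" e] by simp
qed

lemma good_below_None:
  assumes "good Q p M" "child p d = None"
  shows "M (d # \<pi>) = None"
proof (cases "M (d # \<pi>)")
  case (Some l)
  with assms(1) show ?thesis by (rule good_subat) (use assms(2) in simp)
qed

text \<open>Converse of \<open>good_below\<close> and \<open>good_below_None\<close>, by which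
  markings are assembled from the children.\<close>

lemma good_Open:
  assumes "M [] = Some Open"
    and child: "\<And>d c. child p d = Some c \<Longrightarrow> good Q c (below M d)"
    and no_child: "\<And>d \<pi>. child p d = None \<Longrightarrow> M (d # \<pi>) = None"
  shows "good Q p M"
proof (rule goodI)
  fix \<pi> l assume l: "M \<pi> = Some l"
  show "\<exists>r. subat p \<pi> = Some r \<and> (\<forall>q. l = Mark q \<longrightarrow> Q r q)"
  proof (cases \<pi>)
    case Nil
    then show ?thesis using l assms(1) by simp
  next
    case (Cons d \<pi>')
    show ?thesis
    proof (cases "child p d")
      case None
      then show ?thesis using no_child[OF None, of \<pi>'] l Cons by simp
    next
      case (Some c)
      from child[OF Some] l[unfolded Cons] show ?thesis
        by (rule good_subat) (simp add: Cons Some)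
    qed
  qed
next
  fix \<pi> e assume l: "M (\<pi> @ [e]) \<noteq> None"
  show "M \<pi> = Some Open"
  proof (cases \<pi>)
    case Nil
    then show ?thesis using assms(1) by simp
  next
    case (Cons d \<pi>')
    show ?thesis
    proof (cases "child p d")
      case None
      then show ?thesis using no_child[OF None, of "\<pi>' @ [e]"] l Cons by simp
    next
      case (Some c)
      from good_snoc[OF child[OF Some], of \<pi>' e] l Cons show ?thesis by simp
    qed
  qed
qed

lemma fv_decode:
  "good Q p M \<Longrightarrow> (\<And>r q. Q r q \<Longrightarrow> fv q = {}) \<Longrightarrow> fv (decode p M) \<subseteq> fv p"
proof (induction p arbitrary: M rule: trm_induct)
  case (Var x)
  then show ?case by (cases "\<exists>q. M [] = Some (Mark q)") (auto simp: decode_Var dest: good_MarkD)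
next
  case (Fun f ts)
  show ?case
  proof (cases "\<exists>q. M [] = Some (Mark q)")
    case False
    have "fv (decode (ts ! i) (below M (Inr i))) \<subseteq> fv (ts ! i)" if "i < length ts" for i
      by (rule Fun.IH) (use that Fun.prems good_below[of Q "Fun f ts" M "Inr i"] in auto)
    then show ?thesis using False by (fastforce simp: decode_Fun)
  qed (use Fun.prems good_MarkD in fastforce)
next
  case (Rec X S)
  show ?case
  proof (cases "\<exists>q. M [] = Some (Mark q)")
    case False
    have "fv (decode t (below M (Inl Y))) \<subseteq> fv t" if "S Y = Some t" for Y t
      by (rule Rec.IH[OF that]) (use that Rec.prems good_below[of Q "Rec X S" M "Inl Y"] in auto)
    then show ?thesis using False by (fastforce simp: decode_Rec fv_Rec ran_def)
  qed (use Rec.prems good_MarkD in fastforce)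
qed

lemma wf_trm_decode:
  "good Q p M \<Longrightarrow> (\<And>r q. Q r q \<Longrightarrow> wf_trm \<Sigma> q) \<Longrightarrow> wf_trm \<Sigma> p \<Longrightarrow> wf_trm \<Sigma> (decode p M)"
proof (induction p arbitrary: M rule: trm_induct)
  case (Var x)
  then show ?case by (cases "\<exists>q. M [] = Some (Mark q)") (auto simp: decode_Var dest: good_MarkD)
next
  case (Fun f ts)
  show ?case
  proof (cases "\<exists>q. M [] = Some (Mark q)")
    case False
    have "wf_trm \<Sigma> (decode (ts ! i) (below M (Inr i)))" if "i < length ts" for i
      by (rule Fun.IH) (use that Fun.prems good_below[of Q "Fun f ts" M "Inr i"] in \<open>auto simp: list_all_iff\<close>)
    then show ?thesis using False Fun.prems(3) by (auto simp: decode_Fun list_all_iff)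
  qed (use Fun.prems good_MarkD in fastforce)
next
  case (Rec X S)
  show ?case
  proof (cases "\<exists>q. M [] = Some (Mark q)")
    case False
    have "wf_trm \<Sigma> (decode t (below M (Inl Y)))" if "S Y = Some t" for Y t
      by (rule Rec.IH[OF that]) (use that Rec.prems good_below[of Q "Rec X S" M "Inl Y"] in \<open>auto simp: wf_trm_Rec ran_def\<close>)
    then show ?thesis using False Rec.prems(3) by (auto simp: decode_Rec wf_trm_Rec ran_def)
  qed (use Rec.prems good_MarkD in fastforce)
qed

lemma decode_closed_trms:
  assumes "good Q p M" "\<And>r q. Q r q \<Longrightarrow> q \<in> closed_trms \<Sigma>" "p \<in> closed_trms \<Sigma>"
  shows "decode p M \<in> closed_trms \<Sigma>"
  using fv_decode[OF assms(1)] wf_trm_decode[OF assms(1), of \<Sigma>] assms(2,3)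
  unfolding closed_trms_def by fastforce

text \<open>
  The marking of \<open>subst t \<sigma>\<close> obtained from a marking \<open>N\<close> of \<open>t\<close> and markings \<open>m v\<close> of the terms
  \<open>\<sigma> v\<close>. Labels of \<open>N\<close> matter only at closed subterms; all other positions of \<open>t\<close> are forced to be
  \<open>Open\<close>, which is what makes the operation monotone in \<open>N\<close>.
\<close>

primrec graft :: "('f, 'v) trm \<Rightarrow> ('f, 'v) marking \<Rightarrow> ('v \<Rightarrow> ('f, 'v) marking) \<Rightarrow> ('f, 'v) marking" where
  "graft (Var x) N m = m x"
| "graft (Fun f ts) N m = (if fv (Fun f ts) = {} then N else (\<lambda>\<pi>. case \<pi> of
       [] \<Rightarrow> Some Open
     | Inl Y # \<pi>' \<Rightarrow> None
     | Inr i # \<pi>' \<Rightarrow> if i < length ts then (map graft ts ! i) (below N (Inr i)) m \<pi>' else None))"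
| "graft (Rec X S) N m = (if fv (Rec X S) = {} then N else (\<lambda>\<pi>. case \<pi> of
       [] \<Rightarrow> Some Open
     | Inl Y # \<pi>' \<Rightarrow> (case map_option graft (S Y) of None \<Rightarrow> None
         | Some g \<Rightarrow> g (below N (Inl Y)) (\<lambda>v. if v \<in> dom S then (\<lambda>\<pi>. None) else m v) \<pi>')
     | Inr i # \<pi>' \<Rightarrow> None))"

declare graft.simps(2,3) [simp del]

lemma graft_closed: "fv t = {} \<Longrightarrow> graft t N m = N"
  by (cases t) (auto simp: graft.simps)

lemma graft_Nil: "fv t \<noteq> {} \<Longrightarrow> (\<And>x. t \<noteq> Var x) \<Longrightarrow> graft t N m [] = Some Open"
  by (cases t) (auto simp: graft.simps)

lemma graft_Fun:
  "fv (Fun f ts) \<noteq> {} \<Longrightarrow> i < length ts \<Longrightarrow>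
     below (graft (Fun f ts) N m) (Inr i) = graft (ts ! i) (below N (Inr i)) m"
  by (subst graft.simps(2)) (simp del: fv.simps)

lemma graft_Rec:
  "fv (Rec X S) \<noteq> {} \<Longrightarrow> S Y = Some t \<Longrightarrow>
     below (graft (Rec X S) N m) (Inl Y) =
       graft t (below N (Inl Y)) (\<lambda>v. if v \<in> dom S then (\<lambda>\<pi>. None) else m v)"
  by (simp add: graft.simps)

lemma graft_no_child:
  "fv t \<noteq> {} \<Longrightarrow> (\<And>x. t \<noteq> Var x) \<Longrightarrow> child t d = None \<Longrightarrow> graft t N m (d # \<pi>) = None"
  by (cases t; cases d) (auto simp: graft.simps split: if_splits)

lemma map_leI: "(\<And>x y. f x = Some y \<Longrightarrow> g x = Some y) \<Longrightarrow> f \<subseteq>\<^sub>m g"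
  by (auto simp: map_le_def)

lemma map_leD: "f \<subseteq>\<^sub>m g \<Longrightarrow> f x = Some y \<Longrightarrow> g x = Some y"
  by (metis domI map_le_def)

lemma map_le_below: "M \<subseteq>\<^sub>m M' \<Longrightarrow> below M d \<subseteq>\<^sub>m below M' d"
  by (rule map_leI) (rule map_leD)

lemma map_le_positions:
  assumes "f [] = g []" "\<And>d. below f d \<subseteq>\<^sub>m below g d"
  shows "f \<subseteq>\<^sub>m g"
proof (rule map_leI)
  fix \<pi> y assume "f \<pi> = Some y"
  then show "g \<pi> = Some y" using assms(1) map_leD[OF assms(2)] by (cases \<pi>) simp_all
qed

lemma graft_mono:
  "N \<subseteq>\<^sub>m N' \<Longrightarrow> (\<And>v. m v \<subseteq>\<^sub>m m' v) \<Longrightarrow> graft t N m \<subseteq>\<^sub>m graft t N' m'"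
proof (induction t arbitrary: N N' m m' rule: trm_induct)
  case (Fun f ts)
  show ?case
  proof (cases "fv (Fun f ts) = {}")
    case True
    then show ?thesis using Fun.prems(1) by (simp only: graft_closed)
  next
    case False
    show ?thesis
    proof (rule map_le_positions)
      fix d
      show "below (graft (Fun f ts) N m) d \<subseteq>\<^sub>m below (graft (Fun f ts) N' m') d"
      proof (cases "child (Fun f ts) d")
        case None
        then show ?thesis using graft_no_child[OF False _ None] by auto
      next
        case (Some c)
        then obtain i where i: "d = Inr i" "i < length ts" by (cases d) (auto split: if_splits)
        show ?thesis
          unfolding i(1) graft_Fun[OF False i(2)]
          by (rule Fun.IH) (use i Fun.prems map_le_below in auto)
      qed
    qed (use graft_Nil[OF False] in auto)
  qed
next
  case (Rec X S)
  show ?case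
  proof (cases "fv (Rec X S) = {}")
    case True
    then show ?thesis using Rec.prems(1) by (simp only: graft_closed)
  next
    case False
    show ?thesis
    proof (rule map_le_positions)
      fix d
      show "below (graft (Rec X S) N m) d \<subseteq>\<^sub>m below (graft (Rec X S) N' m') d"
      proof (cases "child (Rec X S) d")
        case None
        then show ?thesis using graft_no_child[OF False _ None] by auto
      next
        case (Some c)
        then obtain Y where Y: "d = Inl Y" "S Y = Some c" by (cases d) auto
        show ?thesis
          unfolding Y(1) graft_Rec[OF False Y(2)]
          by (rule Rec.IH[OF Y(2)]) (use Rec.prems map_le_below in auto)
      qed
    qed (use graft_Nil[OF False] in auto)
  qed
qed simp

lemma good_graft:
  "good Q t N \<Longrightarrow> (\<And>v. v \<in> fv t \<Longrightarrow> good Q (\<sigma> v) (m v)) \<Longrightarrow> good Q (subst t \<sigma>) (graft t N m)"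
proof (induction t arbitrary: N \<sigma> m rule: trm_induct)
  case (Fun f ts)
  show ?case
  proof (cases "fv (Fun f ts) = {}")
    case True
    then show ?thesis using Fun.prems(1) by (simp only: graft_closed subst_closed)
  next
    case False
    show ?thesis
    proof (rule good_Open)
      fix d c assume "child (subst (Fun f ts) \<sigma>) d = Some c"
      then obtain i where i: "d = Inr i" "i < length ts" "c = subst (ts ! i) \<sigma>"
        by (cases d) (auto split: if_splits)
      show "good Q c (below (graft (Fun f ts) N m) d)"
        unfolding i(1,3) graft_Fun[OF False i(2)]
      proof (rule Fun.IH)
        show "good Q (ts ! i) (below N (Inr i))" using good_below[OF Fun.prems(1), of "Inr i"] i by simp
      qed (use i Fun.prems(2) nth_mem[OF i(2)] in fastforce)+
    next
      fix d \<pi> assume "child (subst (Fun f ts) \<sigma>) d = None"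
      then have "child (Fun f ts) d = None" by (cases d) (auto split: if_splits)
      then show "graft (Fun f ts) N m (d # \<pi>) = None" using graft_no_child[OF False] by auto
    qed (use graft_Nil[OF False] in auto)
  qed
next
  case (Rec X S)
  show ?case
  proof (cases "fv (Rec X S) = {}")
    case True
    then show ?thesis using Rec.prems(1) by (simp only: graft_closed subst_closed)
  next
    case False
    show ?thesis
    proof (rule good_Open)
      fix d c assume "child (subst (Rec X S) \<sigma>) d = Some c"
      then obtain Y t where Y: "d = Inl Y" "S Y = Some t" "c = subst t (\<lambda>v. if v \<in> dom S then Var v else \<sigma> v)"
        by (cases d) auto
      show "good Q c (below (graft (Rec X S) N m) d)"
        unfolding Y(1,3) graft_Rec[OF False Y(2)]
      proof (rule Rec.IH[OF Y(2)])
        show "good Q t (below N (Inl Y))" using good_below[OF Rec.prems(1), of "Inl Y"] Y by simp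
        fix v assume "v \<in> fv t"
        then have "v \<in> fv (Rec X S)" if "v \<notin> dom S"
          using that Y(2) unfolding fv_Rec ran_def by blast
        \<comment> \<open>The substitution leaves bound variables in place, so they get the empty
          marking, which is good for every term.\<close>
        then show "good Q (if v \<in> dom S then Var v else \<sigma> v) (if v \<in> dom S then (\<lambda>\<pi>. None) else m v)"
          using Rec.prems(2)[of v] by simp
      qed
    next
      fix d \<pi> assume "child (subst (Rec X S) \<sigma>) d = None"
      then have "child (Rec X S) d = None" by (cases d) auto
      then show "graft (Rec X S) N m (d # \<pi>) = None" using graft_no_child[OF False] by auto
    qed (use graft_Nil[OF False] in auto)
  qed
qed simp

text \<open>\<open>Q\<close> relates closed terms only, so \<open>N\<close> has no mark at a subterm
  with free variables, and there both sides proceed to the children or to the value of the variable.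
  At a closed subterm both sides are \<open>decode t N\<close>, which is closed again and thus
  unaffected by the substitution.\<close>

lemma decode_graft:
  assumes "good Q t N" and closed: "\<And>r q. Q r q \<Longrightarrow> fv r = {} \<and> fv q = {}"
  shows "decode (subst t \<sigma>) (graft t N m) = subst (decode t N) (\<lambda>v. decode (\<sigma> v) (m v))"
  using assms(1)
proof (induction t arbitrary: N \<sigma> m rule: trm_induct)
  case (Var x)
  have "N [] \<noteq> Some (Mark q)" for q using good_MarkD[OF Var] closed by fastforce
  then show ?case by (simp add: decode_Var)
next
  case (Fun f ts)
  show ?case
  proof (cases "fv (Fun f ts) = {}")
    case True
    then have "fv (decode (Fun f ts) N) = {}" using fv_decode[OF Fun.prems] closed by blast
    with True show ?thesis by (simp only: graft_closed subst_closed)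
  next
    case False
    then have "N [] \<noteq> Some (Mark q)" for q using good_MarkD[OF Fun.prems] closed by fastforce
    moreover have "graft (Fun f ts) N m [] \<noteq> Some (Mark q)" for q using graft_Nil[OF False] by auto
    moreover have "decode (subst (ts ! i) \<sigma>) (below (graft (Fun f ts) N m) (Inr i)) =
        subst (decode (ts ! i) (below N (Inr i))) (\<lambda>v. decode (\<sigma> v) (m v))" if i: "i < length ts" for i
      unfolding graft_Fun[OF False i]
      by (rule Fun.IH) (use i good_below[OF Fun.prems, of "Inr i"] in auto)
    ultimately show ?thesis by (simp add: decode_Fun)
  qed
next
  case (Rec X S)
  show ?case
  proof (cases "fv (Rec X S) = {}")
    case True
    then have "fv (decode (Rec X S) N) = {}" using fv_decode[OF Rec.prems] closed by blast
    with True show ?thesis by (simp only: graft_closed subst_closed)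
  next
    case False
    have 1: "N [] \<noteq> Some (Mark q)" for q using False good_MarkD[OF Rec.prems] closed by fastforce
    have 2: "graft (Rec X S) N m [] \<noteq> Some (Mark q)" for q using graft_Nil[OF False] by auto
    let ?\<sigma> = "\<lambda>v. if v \<in> dom S then Var v else \<sigma> v"
    let ?\<sigma>' = "\<lambda>v. if v \<in> dom S then Var v else decode (\<sigma> v) (m v)"
    have 3: "decode (subst t ?\<sigma>) (below (graft (Rec X S) N m) (Inl Y)) =
        subst (decode t (below N (Inl Y))) ?\<sigma>'" if Y: "S Y = Some t" for Y t
    proof -
      let ?m = "\<lambda>v. if v \<in> dom S then (\<lambda>\<pi>. None) else m v"
      have "(\<lambda>v. decode (?\<sigma> v) (?m v)) = ?\<sigma>'" by auto
      then show ?thesis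
        unfolding graft_Rec[OF False Y]
        using Rec.IH[OF Y, of "below N (Inl Y)" ?\<sigma> ?m] good_below[OF Rec.prems, of "Inl Y"] Y by simp
    qed
    have "map_option (\<lambda>t. decode (subst t ?\<sigma>) (below (graft (Rec X S) N m) (Inl Y))) (S Y) =
       map_option (\<lambda>t. subst (decode t (below N (Inl Y))) ?\<sigma>') (S Y)" for Y
      using 3[of Y] by (cases "S Y") simp_all
    \<comment> \<open>Decoding keeps the domain of the specification, so \<open>subst\<close>
      protects the same variables on both sides.\<close>
    moreover have "dom (\<lambda>Y. map_option (\<lambda>t. decode t (below N (Inl Y))) (S Y)) = dom S"
      by (auto simp: dom_def)
    ultimately show ?thesis using 1 2 by (simp add: decode_Rec option.map_comp comp_def)
  qed
qed

section \<open>Marked positions after decoding, and the exchange of marks\<close>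

lemma child_decode:
  "(\<And>q. M [] \<noteq> Some (Mark q)) \<Longrightarrow>
     child (decode p M) d = map_option (\<lambda>c. decode c (below M d)) (child p d)"
  by (cases p; cases d) (simp_all add: decode_Var decode_Fun decode_Rec)

text \<open>Every proper prefix of a labelled position is \<open>Open\<close>, so decoding leaves
  the path to it intact.\<close>

lemma subat_decode:
  "good Q p M \<Longrightarrow> M \<pi> = Some l \<Longrightarrow> \<exists>r. subat (decode p M) \<pi> = Some r \<and> (\<forall>q. l = Mark q \<longrightarrow> r = q)"
proof (induction \<pi> arbitrary: p M)
  case Nil
  then show ?case by (cases l) auto
next
  case (Cons d \<pi>)
  then have "M [] = Some Open" using good_prefix[of Q p M d \<pi>] by simp
  then have *: "child (decode p M) d = map_option (\<lambda>c. decode c (below M d)) (child p d)"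
    by (intro child_decode) simp
  obtain c where "child p d = Some c"
    using good_below_None[OF Cons.prems(1)] Cons.prems(2) by (cases "child p d") auto
  then show ?case using * Cons.IH[OF good_below[OF Cons.prems(1)] Cons.prems(2)] by simp
qed

text \<open>Serves to undo a replacement and to factor one into two successive replacements at the
  same positions.\<close>

definition remark :: "('f, 'v) marking \<Rightarrow> ('v pos \<Rightarrow> ('f, 'v) trm) \<Rightarrow> ('f, 'v) marking" where
  "remark M h = (\<lambda>\<pi>. map_option (\<lambda>l. case l of Open \<Rightarrow> Open | Mark q \<Rightarrow> Mark (h \<pi>)) (M \<pi>))"

lemma below_remark: "below (remark M h) d = remark (below M d) (\<lambda>\<pi>. h (d # \<pi>))"
  by (simp add: remark_def)

lemma remark_cases:
  obtains "M \<pi> = None" "remark M h \<pi> = None"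
  | "M \<pi> = Some Open" "remark M h \<pi> = Some Open"
  | q where "M \<pi> = Some (Mark q)" "remark M h \<pi> = Some (Mark (h \<pi>))"
  by (cases "M \<pi>"; cases "the (M \<pi>)") (auto simp: remark_def)

text \<open>The first decoding alters only marked subterms, and these are exactly what the second
  one overwrites.\<close>

lemma decode_remark:
  "decode (decode p M) (remark M h) = decode p (remark M h)"
proof (induction p arbitrary: M h rule: trm_induct)
  case (Var x)
  show ?case by (rule remark_cases[of M "[]" h]) (simp_all add: decode_Var)
next
  case (Fun f ts)
  show ?case
    by (rule remark_cases[of M "[]" h])
      (simp_all add: decode_Fun below_remark Fun.IH)
next
  case (Rec X S)
  have *: "map_option (\<lambda>t. decode (decode t (below M (Inl Y))) (below (remark M h) (Inl Y))) (S Y)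
     = map_option (\<lambda>t. decode t (below (remark M h) (Inl Y))) (S Y)" for Y
    unfolding below_remark by (cases "S Y") (simp_all add: Rec.IH)
  show ?case
    by (rule remark_cases[of M "[]" h])
      (simp_all add: decode_Rec option.map_comp comp_def *)
qed

lemma good_remark_decode:
  assumes "good Q p M" "\<And>\<pi> r q. subat p \<pi> = Some r \<Longrightarrow> M \<pi> = Some (Mark q) \<Longrightarrow> Q r q \<Longrightarrow> Q' q (h \<pi>)"
  shows "good Q' (decode p M) (remark M h)"
proof (rule goodI)
  fix \<pi> l assume l: "remark M h \<pi> = Some l"
  show "\<exists>r. subat (decode p M) \<pi> = Some r \<and> (\<forall>q. l = Mark q \<longrightarrow> Q' r q)"
  proof (rule remark_cases[of M \<pi> h])
    fix q assume q: "M \<pi> = Some (Mark q)" "remark M h \<pi> = Some (Mark (h \<pi>))"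
    with assms(1) obtain r where "subat p \<pi> = Some r" "Q r q" by (auto elim: good_subat)
    with assms(2) q have "Q' q (h \<pi>)" by simp
    with subat_decode[OF assms(1) q(1)] q(2) l show ?thesis by auto
  qed (use l subat_decode[OF assms(1), of \<pi> Open] in auto)
next
  fix \<pi> d assume "remark M h (\<pi> @ [d]) \<noteq> None"
  then have "M (\<pi> @ [d]) \<noteq> None" by (simp add: remark_def)
  from good_snoc[OF assms(1) this] show "remark M h \<pi> = Some Open" by (simp add: remark_def)
qed

lemma good_remark:
  assumes "good Q p M" "\<And>\<pi> r q. subat p \<pi> = Some r \<Longrightarrow> M \<pi> = Some (Mark q) \<Longrightarrow> Q r q \<Longrightarrow> Q' r (h \<pi>)"
  shows "good Q' p (remark M h)"
proof (rule goodI)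
  fix \<pi> l assume l: "remark M h \<pi> = Some l"
  then obtain l' where l': "M \<pi> = Some l'" by (auto simp: remark_def)
  from assms(1) l' show "\<exists>r. subat p \<pi> = Some r \<and> (\<forall>q. l = Mark q \<longrightarrow> Q' r q)"
    by (rule good_subat) (use l l' assms(2) in \<open>auto simp: remark_def split: lab.splits\<close>)
next
  fix \<pi> d assume "remark M h (\<pi> @ [d]) \<noteq> None"
  then have "M (\<pi> @ [d]) \<noteq> None" by (simp add: remark_def)
  from good_snoc[OF assms(1) this] show "remark M h \<pi> = Some Open" by (simp add: remark_def)
qed

lemma decode_subat:
  "(\<And>\<pi> q. M \<pi> = Some (Mark q) \<Longrightarrow> subat p \<pi> = Some q) \<Longrightarrow> decode p M = p"
proof (induction p arbitrary: M rule: trm_induct)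
  case (Var x)
  show ?case
    by (cases "\<exists>q. M [] = Some (Mark q)") (use Var[of "[]"] in \<open>auto simp: decode_Var\<close>)
next
  case (Fun f ts)
  show ?case
  proof (cases "\<exists>q. M [] = Some (Mark q)")
    case False
    have "decode (ts ! i) (below M (Inr i)) = ts ! i" if i: "i < length ts" for i
    proof (rule Fun.IH)
      fix \<pi> q assume "M (Inr i # \<pi>) = Some (Mark q)"
      from Fun.prems[OF this] i show "subat (ts ! i) \<pi> = Some q" by simp
    qed (use i in simp)
    then have "map (\<lambda>i. decode (ts ! i) (below M (Inr i))) [0..<length ts] = ts"
      by (intro nth_equalityI) simp_all
    then show ?thesis using False by (simp add: decode_Fun)
  qed (use Fun.prems[of "[]"] in auto)
next
  case (Rec X S)
  show ?case
  proof (cases "\<exists>q. M [] = Some (Mark q)")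
    case False
    have "decode t (below M (Inl Y)) = t" if Y: "S Y = Some t" for Y t
    proof (rule Rec.IH[OF Y])
      fix \<pi> q assume "M (Inl Y # \<pi>) = Some (Mark q)"
      from Rec.prems[OF this] Y show "subat t \<pi> = Some q" by simp
    qed
    then have "map_option (\<lambda>t. decode t (below M (Inl Y))) (S Y) = S Y" for Y
      by (cases "S Y") simp_all
    then show ?thesis using False by (simp add: decode_Rec)
  qed (use Rec.prems[of "[]"] in auto)
qed

text \<open>Putting the original subterms of \<open>p\<close> back at the marked positions of the
  decoded term inverts the replacement; symmetry of \<open>Q\<close> makes these marks
  admissible.\<close>

lemma decode_symmetric:
  assumes "good Q p M" "\<And>r q. Q r q \<Longrightarrow> Q q r"
  obtains N where "good Q (decode p M) N" "decode (decode p M) N = p"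
proof
  let ?h = "\<lambda>\<pi>. the (subat p \<pi>)"
  show "good Q (decode p M) (remark M ?h)"
    by (rule good_remark_decode[OF assms(1)]) (simp add: assms(2))
  have "decode p (remark M ?h) = p"
  proof (rule decode_subat)
    fix \<pi> q assume q: "remark M ?h \<pi> = Some (Mark q)"
    then obtain l where "M \<pi> = Some l" by (auto simp: remark_def)
    with assms(1) obtain r where "subat p \<pi> = Some r" by (rule good_subat)
    then show "subat p \<pi> = Some q" using q by (cases rule: remark_cases[of M \<pi> ?h]) auto
  qed
  then show "decode (decode p M) (remark M ?h) = p" by (simp add: decode_remark)
qed

section \<open>Least fixed points of monotone operators on partial maps\<close>

definition map_fixp :: "(('x \<rightharpoonup> 'y) \<Rightarrow> ('x \<rightharpoonup> 'y)) \<Rightarrow> ('x \<rightharpoonup> 'y)" where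
  "map_fixp = ccpo.fixp (fun_lub (flat_lub None)) (\<subseteq>\<^sub>m)"

text \<open>\<open>\<subseteq>\<^sub>m\<close> is the flat order on options taken pointwise, with
  \<open>None\<close> as bottom, so the structure known for partial functions transfers.\<close>

lemma map_le_ccpo: "class.ccpo (fun_lub (flat_lub None)) (\<subseteq>\<^sub>m) (mk_less (\<subseteq>\<^sub>m))"
proof -
  have "fun_ord (flat_ord None) = ((\<subseteq>\<^sub>m) :: ('x \<rightharpoonup> 'y) \<Rightarrow> _)"
  proof (intro ext iffI)
    fix f g :: "'x \<rightharpoonup> 'y" assume *: "fun_ord (flat_ord None) f g"
    show "f \<subseteq>\<^sub>m g"
    proof (rule map_leI)
      fix x y assume "f x = Some y"
      with *[unfolded fun_ord_def flat_ord_def, rule_format, of x] show "g x = Some y" by simp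
    qed
  next
    fix f g :: "'x \<rightharpoonup> 'y" assume "f \<subseteq>\<^sub>m g"
    then have "f x = None \<or> f x = g x" for x
      using map_leD[of f g x] by (cases "f x") simp_all
    then show "fun_ord (flat_ord None) f g" by (simp add: fun_ord_def flat_ord_def)
  qed
  from option.ccpo[unfolded this] show ?thesis .
qed

lemma map_fixp_unfold:
  assumes "\<And>f g. f \<subseteq>\<^sub>m g \<Longrightarrow> \<Phi> f \<subseteq>\<^sub>m \<Phi> g"
  shows "map_fixp \<Phi> = \<Phi> (map_fixp \<Phi>)"
  unfolding map_fixp_def
  by (rule ccpo.fixp_unfold[OF map_le_ccpo]) (simp add: monotone_def assms)

text \<open>The least fixed point of \<Psi> is mapped below itself by \<Phi>, and the least fixed
  point of \<Phi> lies below every such map.\<close>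

lemma map_fixp_mono:
  assumes "\<And>f g. f \<subseteq>\<^sub>m g \<Longrightarrow> \<Phi> f \<subseteq>\<^sub>m \<Phi> g" "\<And>f g. f \<subseteq>\<^sub>m g \<Longrightarrow> \<Psi> f \<subseteq>\<^sub>m \<Psi> g"
    and "\<And>f. \<Phi> f \<subseteq>\<^sub>m \<Psi> f"
  shows "map_fixp \<Phi> \<subseteq>\<^sub>m map_fixp \<Psi>"
proof -
  have "\<Phi> (map_fixp \<Psi>) \<subseteq>\<^sub>m map_fixp \<Psi>"
    by (rule back_subst[where P = "(\<subseteq>\<^sub>m) (\<Phi> (map_fixp \<Psi>))", OF assms(3)
          map_fixp_unfold[of \<Psi>, OF assms(2), symmetric]])
  then show ?thesis
    unfolding map_fixp_def
    by (intro ccpo.fixp_lowerbound[OF map_le_ccpo]) (simp_all add: monotone_def assms(1))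
qed

lemma map_lub_eq_Some_iff:
  assumes "Complete_Partial_Order.chain (\<subseteq>\<^sub>m) A"
  shows "fun_lub (flat_lub None) A x = Some y \<longleftrightarrow> (\<exists>f \<in> A. f x = Some y)"
proof
  assume "fun_lub (flat_lub None) A x = Some y"
  then have y: "flat_lub None {y. \<exists>f\<in>A. y = f x} = Some y" by (simp add: fun_lub_def)
  have "\<exists>f \<in> A. f x \<noteq> None"
  proof (rule ccontr)
    assume "\<not> ?thesis"
    \<comment> \<open>\<open>flat_lub None\<close> returns \<open>None\<close> on a set without
      defined values.\<close>
    then have "{y. \<exists>f\<in>A. y = f x} \<subseteq> {None}" by auto
    with y show False by (simp add: flat_lub_def)
  qed
  then obtain f z where f: "f \<in> A" "f x = Some z" by (elim bexE) auto
  have "fun_lub (flat_lub None) A x = Some z"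
    using ccpo.ccpo_Sup_upper[OF map_le_ccpo assms f(1)] f(2) by (rule map_leD)
  with y have "z = y" by (simp add: fun_lub_def)
  with f show "\<exists>f \<in> A. f x = Some y" by (intro bexI[of _ f]) simp_all
next
  assume "\<exists>f \<in> A. f x = Some y"
  then show "fun_lub (flat_lub None) A x = Some y"
    using ccpo.ccpo_Sup_upper[OF map_le_ccpo assms] by (elim bexE) (rule map_leD)
qed

text \<open>Admissibility becomes closure under unions of graphs, with no reference to chains.
  \<open>good_lub\<close> supplies it for \<open>good\<close>, since each label of the union already
  occurs in a member.\<close>

lemma map_fixp_induct:
  assumes mono: "\<And>f g. f \<subseteq>\<^sub>m g \<Longrightarrow> \<Phi> f \<subseteq>\<^sub>m \<Phi> g"
    and "P (\<lambda>x. None)" "\<And>f. P f \<Longrightarrow> P (\<Phi> f)"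
    and lub: "\<And>A g. (\<And>x y. g x = Some y \<longleftrightarrow> (\<exists>f \<in> A. f x = Some y)) \<Longrightarrow> (\<And>f. f \<in> A \<Longrightarrow> P f) \<Longrightarrow> P g"
  shows "P (map_fixp \<Phi>)"
  unfolding map_fixp_def
proof (rule ccpo.fixp_induct[OF map_le_ccpo])
  show "ccpo.admissible (fun_lub (flat_lub None)) (\<subseteq>\<^sub>m) P"
  proof (rule ccpo.admissibleI)
    fix A :: "('a \<rightharpoonup> 'b) set"
    assume A: "Complete_Partial_Order.chain (\<subseteq>\<^sub>m) A" "\<forall>f \<in> A. P f"
    show "P (fun_lub (flat_lub None) A)"
      by (rule lub[of _ A]) (simp_all add: map_lub_eq_Some_iff[OF A(1)] A(2))
  qed
  have "fun_lub (flat_lub None) {} = (\<lambda>x :: 'a. None :: 'b option)"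
    by (simp add: fun_lub_def flat_lub_def)
  then show "P (fun_lub (flat_lub None) {})" using assms(2) by simp
qed (simp_all add: monotone_def mono assms(3))

section \<open>Replaying proofs along markings\<close>

lemma good_lub:
  assumes "\<And>\<pi> l. M \<pi> = Some l \<longleftrightarrow> (\<exists>N \<in> A. N \<pi> = Some l)" "\<And>N. N \<in> A \<Longrightarrow> good Q p N"
  shows "good Q p M"
proof (rule goodI)
  fix \<pi> l assume "M \<pi> = Some l"
  then obtain N where "N \<in> A" "N \<pi> = Some l" using assms(1) by auto
  from assms(2)[OF this(1)] this(2) show "\<exists>r. subat p \<pi> = Some r \<and> (\<forall>q. l = Mark q \<longrightarrow> Q r q)"
    by (rule good_subat) simp
next
  fix \<pi> d assume "M (\<pi> @ [d]) \<noteq> None"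
  then obtain l where "M (\<pi> @ [d]) = Some l" by blast
  then obtain N where N: "N \<in> A" "N (\<pi> @ [d]) = Some l" using assms(1) by auto
  then have "N \<pi> = Some Open" using good_snoc[OF assms(2)[OF N(1)], of \<pi> d] by simp
  then show "M \<pi> = Some Open" using N(1) assms(1) by auto
qed

text \<open>
  Monotonicity of \<open>F\<close> is part of the definition because the values of cyclic premises are obtained
  as a fixed point. The parameter \<open>D\<close> restricts the markings that have to be treated.
\<close>

definition replay ::
  "('f \<times> nat) set \<Rightarrow> ('f, 'v, 'a) rule set \<Rightarrow> (('f, 'v) trm \<Rightarrow> ('f, 'v) trm \<Rightarrow> bool) \<Rightarrow>
     (('f, 'v) marking \<Rightarrow> bool) \<Rightarrow> ('f, 'v) trm \<Rightarrow> 'a \<Rightarrow> ('f, 'v) trm \<Rightarrow> bool" where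
  "replay \<Sigma> R Q D p a p' \<longleftrightarrow> (\<exists>F. (\<forall>M M'. M \<subseteq>\<^sub>m M' \<longrightarrow> F M \<subseteq>\<^sub>m F M') \<and>
     (\<forall>M. D M \<longrightarrow> good Q p M \<longrightarrow> good Q p' (F M) \<and> proves \<Sigma> R (decode p M) a (decode p' (F M))))"

lemma replayI:
  assumes "\<And>M M'. M \<subseteq>\<^sub>m M' \<Longrightarrow> F M \<subseteq>\<^sub>m F M'"
    and "\<And>M. D M \<Longrightarrow> good Q p M \<Longrightarrow> good Q p' (F M)"
    and "\<And>M. D M \<Longrightarrow> good Q p M \<Longrightarrow> proves \<Sigma> R (decode p M) a (decode p' (F M))"
  shows "replay \<Sigma> R Q D p a p'"
  unfolding replay_def using assms by (intro exI[of _ F]) simp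

lemma replayE:
  assumes "replay \<Sigma> R Q D p a p'"
  obtains F where "\<And>M M'. M \<subseteq>\<^sub>m M' \<Longrightarrow> F M \<subseteq>\<^sub>m F M'"
    and "\<And>M. D M \<Longrightarrow> good Q p M \<Longrightarrow> good Q p' (F M)"
    and "\<And>M. D M \<Longrightarrow> good Q p M \<Longrightarrow> proves \<Sigma> R (decode p M) a (decode p' (F M))"
proof -
  from assms[unfolded replay_def] obtain F where
    F: "\<forall>M M'. M \<subseteq>\<^sub>m M' \<longrightarrow> F M \<subseteq>\<^sub>m F M'"
      "\<forall>M. D M \<longrightarrow> good Q p M \<longrightarrow> good Q p' (F M) \<and> proves \<Sigma> R (decode p M) a (decode p' (F M))"
    by (elim exE conjE)
  show thesis by (rule that[of F]) (simp_all add: F)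
qed

text \<open>\<open>B\<close> marks the values of the variables that no premise determines. The
  marking of a target is obtained by the transformer of its premise from the marking of the
  premise's source, which may again involve targets. This system of monotone equations has a least
  solution \<open>E B\<close>, even for cyclic premises. Distinct targets give one equation per
  variable.\<close>

lemma solve_premises:
  fixes H :: "('f, 'v, 'a) lit set"
  assumes uniq: "\<And>h h'. h \<in> H \<Longrightarrow> h' \<in> H \<Longrightarrow> snd (snd h) = snd (snd h') \<Longrightarrow> h = h'"
    and replay: "\<And>u b y. (u, b, Var y) \<in> H \<Longrightarrow> replay \<Sigma> R Q (\<lambda>M. True) (subst u \<sigma>) b (\<sigma> y)"
    and closed: "\<And>r q. Q r q \<Longrightarrow> fv r = {} \<and> fv q = {}"
  obtains E :: "('v \<Rightarrow> ('f, 'v) marking) \<Rightarrow> 'v \<Rightarrow> ('f, 'v) marking"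
  where "\<And>B B' v. (\<And>v. B v \<subseteq>\<^sub>m B' v) \<Longrightarrow> E B v \<subseteq>\<^sub>m E B' v"
    and "\<And>B v. (\<And>u b. (u, b, Var v) \<notin> H) \<Longrightarrow> E B v = B v"
    and "\<And>B v. (\<And>v. good Q (\<sigma> v) (B v)) \<Longrightarrow> good Q (\<sigma> v) (E B v)"
    and "\<And>B u b y. (\<And>v. good Q (\<sigma> v) (B v)) \<Longrightarrow> (u, b, Var y) \<in> H \<Longrightarrow>
           proves \<Sigma> R (subst u (\<lambda>v. decode (\<sigma> v) (E B v))) b (decode (\<sigma> y) (E B y))"
proof -
  define T where "T = {y. \<exists>u b. (u, b, Var y) \<in> H}"
  define ok where "ok = (\<lambda>y (u, b, F). (u, b, Var y) \<in> H \<and> (\<forall>M M'. M \<subseteq>\<^sub>m M' \<longrightarrow> F M \<subseteq>\<^sub>m F M') \<and>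
     (\<forall>M. good Q (subst u \<sigma>) M \<longrightarrow> good Q (\<sigma> y) (F M) \<and>
        proves \<Sigma> R (decode (subst u \<sigma>) M) b (decode (\<sigma> y) (F M))))"
  have "\<forall>y \<in> T. \<exists>x. ok y x"
  proof
    fix y assume "y \<in> T"
    then obtain u b where h: "(u, b, Var y) \<in> H" unfolding T_def by auto
    from replay[OF h] show "\<exists>x. ok y x"
    proof (rule replayE)
      fix F
      assume "\<And>M M'. M \<subseteq>\<^sub>m M' \<Longrightarrow> F M \<subseteq>\<^sub>m F M'"
        and "\<And>M. True \<Longrightarrow> good Q (subst u \<sigma>) M \<Longrightarrow> good Q (\<sigma> y) (F M)"
        and "\<And>M. True \<Longrightarrow> good Q (subst u \<sigma>) M \<Longrightarrow>
          proves \<Sigma> R (decode (subst u \<sigma>) M) b (decode (\<sigma> y) (F M))"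
      then have "ok y (u, b, F)" by (simp add: ok_def h)
      then show ?thesis ..
    qed
  qed
  \<comment> \<open>Each target selects one premise and one transformer; \<open>U\<close>,
    \<open>L\<close> and \<open>F\<close> are the source, action and transformer so chosen.\<close>
  then obtain c where c: "\<And>y. y \<in> T \<Longrightarrow> ok y (c y)" using bchoice[of T ok] by blast
  define U where "U = (\<lambda>y. fst (c y))"
  define L where "L = (\<lambda>y. fst (snd (c y)))"
  define F where "F = (\<lambda>y. snd (snd (c y)))"
  have ok: "ok y (U y, L y, F y)" if "y \<in> T" for y
    using c[OF that] by (simp add: U_def L_def F_def)
  have H: "(U y, L y, Var y) \<in> H" if "y \<in> T" for y
    using ok[OF that] by (simp add: ok_def)
  have F_mono: "F y M \<subseteq>\<^sub>m F y M'" if "y \<in> T" "M \<subseteq>\<^sub>m M'" for y M M'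
    using ok[OF that(1)] that(2) by (simp add: ok_def)
  have F_good: "good Q (\<sigma> y) (F y M)" if "y \<in> T" "good Q (subst (U y) \<sigma>) M" for y M
    using ok[OF that(1)] that(2) by (simp add: ok_def)
  have F_proves: "proves \<Sigma> R (decode (subst (U y) \<sigma>) M) (L y) (decode (\<sigma> y) (F y M))"
    if "y \<in> T" "good Q (subst (U y) \<sigma>) M" for y M
    using ok[OF that(1)] that(2) by (simp add: ok_def)

  \<comment> \<open>A family of markings is treated as one partial map on pairs of variable and
    position, so that \<open>map_fixp\<close> applies. The rule's own term \<open>U v\<close> gets
    the empty marking: all marks come from the values of its variables.\<close>
  define \<Phi> :: "('v \<Rightarrow> ('f, 'v) marking) \<Rightarrow> ('v \<times> 'v pos \<rightharpoonup> ('f, 'v) lab) \<Rightarrow> ('v \<times> 'v pos \<rightharpoonup> ('f, 'v) lab)" where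
    "\<Phi> = (\<lambda>B e (v, \<pi>). if v \<in> T then F v (graft (U v) (\<lambda>\<pi>. None) (\<lambda>w \<pi>. e (w, \<pi>))) \<pi> else B v \<pi>)"
  define E where "E = (\<lambda>B v \<pi>. map_fixp (\<Phi> B) (v, \<pi>))"
  have \<Phi>_mono: "\<Phi> B e \<subseteq>\<^sub>m \<Phi> B' e'" if "\<And>v. B v \<subseteq>\<^sub>m B' v" "e \<subseteq>\<^sub>m e'" for B B' e e'
  proof (rule map_leI)
    fix x l assume *: "\<Phi> B e x = Some l"
    obtain v \<pi> where x: "x = (v, \<pi>)" by (cases x)
    have "(\<lambda>\<pi>. e (w, \<pi>)) \<subseteq>\<^sub>m (\<lambda>\<pi>. e' (w, \<pi>))" for w
      by (rule map_leI) (rule map_leD[OF that(2)])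
    then have "F v (graft (U v) (\<lambda>\<pi>. None) (\<lambda>w \<pi>. e (w, \<pi>))) \<subseteq>\<^sub>m
        F v (graft (U v) (\<lambda>\<pi>. None) (\<lambda>w \<pi>. e' (w, \<pi>)))" if "v \<in> T"
      by (intro F_mono that graft_mono) simp_all
    then show "\<Phi> B' e' x = Some l"
      using * that(1)[of v] by (auto simp: \<Phi>_def x dest: map_leD split: if_splits)
  qed
  have mono: "\<Phi> B e \<subseteq>\<^sub>m \<Phi> B e'" if "e \<subseteq>\<^sub>m e'" for B e e'
    using \<Phi>_mono that by simp
  have E_unfold: "E B v \<pi> = \<Phi> B (map_fixp (\<Phi> B)) (v, \<pi>)" for B v \<pi>
    unfolding E_def by (rule fun_cong[OF map_fixp_unfold[OF mono]])
  have E_T: "E B v = F v (graft (U v) (\<lambda>\<pi>. None) (E B))" if "v \<in> T" for B v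
  proof
    fix \<pi> show "E B v \<pi> = F v (graft (U v) (\<lambda>\<pi>. None) (E B)) \<pi>"
      unfolding E_unfold[of B v \<pi>] using that by (simp add: \<Phi>_def E_def)
  qed
  have E_not_T: "E B v = B v" if "v \<notin> T" for B v
  proof
    fix \<pi> show "E B v \<pi> = B v \<pi>"
      unfolding E_unfold[of B v \<pi>] using that by (simp add: \<Phi>_def)
  qed
  have E_mono: "E B v \<subseteq>\<^sub>m E B' v" if "\<And>v. B v \<subseteq>\<^sub>m B' v" for B B' v
  proof -
    have "map_fixp (\<Phi> B) \<subseteq>\<^sub>m map_fixp (\<Phi> B')"
      by (intro map_fixp_mono mono \<Phi>_mono that) simp_all
    then show ?thesis unfolding E_def by (intro map_leI) (rule map_leD)
  qed
  have E_good: "good Q (\<sigma> v) (E B v)" if B: "\<And>v. good Q (\<sigma> v) (B v)" for B v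
  proof -
    \<comment> \<open>Goodness is proved for all variables jointly, because the equation of one
      target refers to the others.\<close>
    have "\<forall>v. good Q (\<sigma> v) (\<lambda>\<pi>. map_fixp (\<Phi> B) (v, \<pi>))"
    proof (rule map_fixp_induct[where \<Phi> = "\<Phi> B"])
      fix e assume e: "\<forall>v. good Q (\<sigma> v) (\<lambda>\<pi>. e (v, \<pi>))"
      show "\<forall>v. good Q (\<sigma> v) (\<lambda>\<pi>. \<Phi> B e (v, \<pi>))"
      proof
        fix v
        have "good Q (\<sigma> v) (F v (graft (U v) (\<lambda>\<pi>. None) (\<lambda>w \<pi>. e (w, \<pi>))))" if "v \<in> T"
          by (intro F_good that good_graft) (simp_all add: e)
        then show "good Q (\<sigma> v) (\<lambda>\<pi>. \<Phi> B e (v, \<pi>))"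
          using B[of v] by (cases "v \<in> T") (simp_all add: \<Phi>_def)
      qed
    next
      fix A and g :: "'v \<times> 'v pos \<rightharpoonup> ('f, 'v) lab"
      assume A: "\<And>x y. g x = Some y \<longleftrightarrow> (\<exists>f \<in> A. f x = Some y)"
        "\<And>f. f \<in> A \<Longrightarrow> \<forall>v. good Q (\<sigma> v) (\<lambda>\<pi>. f (v, \<pi>))"
      show "\<forall>v. good Q (\<sigma> v) (\<lambda>\<pi>. g (v, \<pi>))"
      proof
        fix v show "good Q (\<sigma> v) (\<lambda>\<pi>. g (v, \<pi>))"
          by (rule good_lub[where A = "(\<lambda>f \<pi>. f (v, \<pi>)) ` A"]) (use A in auto)
      qed
    qed (simp_all add: mono)
    then show ?thesis by (simp add: E_def)
  qed
  show thesis
  proof (rule that[of E])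
    fix B u b y assume B: "\<And>v. good Q (\<sigma> v) (B v)" and h: "(u, b, Var y) \<in> H"
    have y: "y \<in> T" using h unfolding T_def by blast
    \<comment> \<open>The premise chosen for \<open>y\<close> is the given one, as both have the
      same target.\<close>
    from uniq[OF h H[OF y]] have ub: "u = U y" "b = L y" by simp_all
    have "good Q (subst (U y) \<sigma>) (graft (U y) (\<lambda>\<pi>. None) (E B))"
      by (intro good_graft) (simp_all add: E_good B)
    from F_proves[OF y this]
    have "proves \<Sigma> R (decode (subst (U y) \<sigma>) (graft (U y) (\<lambda>\<pi>. None) (E B))) (L y) (decode (\<sigma> y) (E B y))"
      by (simp add: E_T[OF y])
    then show "proves \<Sigma> R (subst u (\<lambda>v. decode (\<sigma> v) (E B v))) b (decode (\<sigma> y) (E B y))"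
      unfolding ub using decode_graft[of Q "U y" "\<lambda>\<pi>. None" \<sigma> "E B"] closed by simp
  next
    fix B v assume "\<And>u b. (u, b, Var v) \<notin> H"
    then have "v \<notin> T" by (simp add: T_def)
    then show "E B v = B v" by (rule E_not_T)
  qed (simp_all add: E_mono E_good)
qed

section \<open>Bisimilarity and the rule format\<close>

lemma tyft_tyxt_ruleE:
  assumes "tyft_tyxt_rule \<Sigma> (H, (s, a, t))"
  obtains "wf_trm \<Sigma> s" "wf_trm \<Sigma> t"
    and "\<And>u b w. (u, b, w) \<in> H \<Longrightarrow> wf_trm \<Sigma> u \<and> (\<exists>y. w = Var y \<and> y \<notin> fv s)"
    and "\<And>h h'. h \<in> H \<Longrightarrow> h' \<in> H \<Longrightarrow> snd (snd h) = snd (snd h') \<Longrightarrow> h = h'"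
    and "(\<exists>x. s = Var x) \<or> (\<exists>f xs. s = Fun f (map Var xs) \<and> distinct xs)"
proof -
  have *: "wf_trm \<Sigma> s \<and> wf_trm \<Sigma> t \<and> (\<forall>(u, b, v) \<in> H. wf_trm \<Sigma> u \<and> (\<exists>y. v = Var y \<and> y \<notin> fv s)) \<and>
      (\<forall>h \<in> H. \<forall>h' \<in> H. snd (snd h) = snd (snd h') \<longrightarrow> h = h') \<and>
      ((\<exists>x. s = Var x) \<or> (\<exists>f xs. s = Fun f (map Var xs) \<and> distinct xs))"
    using assms unfolding tyft_tyxt_rule_def prod.case .
  show thesis
    by (rule that) (use * in blast)+
qed

lemma proves_closed_trms:
  assumes "\<forall>r \<in> R. tyft_tyxt_rule \<Sigma> r" "proves \<Sigma> R p a q"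
  shows "p \<in> closed_trms \<Sigma> \<and> q \<in> closed_trms \<Sigma>"
  using assms(2)
proof induction
  case (rule H s a t \<sigma>)
  then have "tyft_tyxt_rule \<Sigma> (H, (s, a, t))" using assms(1) by blast
  then show ?case
    by (rule tyft_tyxt_ruleE) (simp add: subst_closed_trms rule)
qed simp

lemma bisimilarI: "bisimulation \<Sigma> R B \<Longrightarrow> (p, q) \<in> B \<Longrightarrow> bisimilar \<Sigma> R p q"
  unfolding bisimilar_def by blast

lemma bisimilar_closed_trms:
  "bisimilar \<Sigma> R p q \<Longrightarrow> p \<in> closed_trms \<Sigma> \<and> q \<in> closed_trms \<Sigma>"
  unfolding bisimilar_def bisimulation_def by blast

lemma bisimilar_sym: "bisimilar \<Sigma> R p q \<Longrightarrow> bisimilar \<Sigma> R q p"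
  unfolding bisimilar_def bisimulation_def by (meson symD)

lemma bisimilar_step:
  assumes "bisimilar \<Sigma> R p q" "proves \<Sigma> R p a p'"
  obtains q' where "proves \<Sigma> R q a q'" "bisimilar \<Sigma> R p' q'"
  using assms unfolding bisimilar_def bisimulation_def by meson

lemma bisimilar_refl:
  assumes "\<forall>r \<in> R. tyft_tyxt_rule \<Sigma> r" "p \<in> closed_trms \<Sigma>"
  shows "bisimilar \<Sigma> R p p"
proof (rule bisimilarI)
  show "bisimulation \<Sigma> R (Id_on (closed_trms \<Sigma>))"
    unfolding bisimulation_def
    using proves_closed_trms[OF assms(1)] by (auto simp: sym_def)
qed (use assms in blast)

lemma bisimilar_trans:
  assumes "bisimilar \<Sigma> R p q" "bisimilar \<Sigma> R q r"
  shows "bisimilar \<Sigma> R p r"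
proof (rule bisimilarI)
  show "bisimulation \<Sigma> R {(p, r). \<exists>q. bisimilar \<Sigma> R p q \<and> bisimilar \<Sigma> R q r}"
    unfolding bisimulation_def
  proof (intro conjI allI impI)
    show "{(p, r). \<exists>q. bisimilar \<Sigma> R p q \<and> bisimilar \<Sigma> R q r} \<subseteq> closed_trms \<Sigma> \<times> closed_trms \<Sigma>"
      using bisimilar_closed_trms[of \<Sigma> R] by blast
    show "sym {(p, r). \<exists>q. bisimilar \<Sigma> R p q \<and> bisimilar \<Sigma> R q r}"
      using bisimilar_sym[of \<Sigma> R] unfolding sym_def by blast
    fix p r a p' assume "(p, r) \<in> {(p, r). \<exists>q. bisimilar \<Sigma> R p q \<and> bisimilar \<Sigma> R q r} \<and> proves \<Sigma> R p a p'"
    then obtain q where q: "bisimilar \<Sigma> R p q" "bisimilar \<Sigma> R q r" "proves \<Sigma> R p a p'" by blast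
    from q(1,3) obtain q' where q': "proves \<Sigma> R q a q'" "bisimilar \<Sigma> R p' q'" by (rule bisimilar_step)
    from q(2) q'(1) obtain r' where "proves \<Sigma> R r a r'" "bisimilar \<Sigma> R q' r'" by (rule bisimilar_step)
    with q' show "\<exists>r'. proves \<Sigma> R r a r' \<and>
        (p', r') \<in> {(p, r). \<exists>q. bisimilar \<Sigma> R p q \<and> bisimilar \<Sigma> R q r}" by blast
  qed
qed (use assms in blast)

section \<open>Replaying a single proof step\<close>

lemma replay_of_open:
  fixes \<Sigma> :: "('f \<times> nat) set" and R :: "('f, 'v, 'a) rule set"
  assumes "replay \<Sigma> R Q (\<lambda>M. M [] = Some Open) p a p'" "proves \<Sigma> R p a p'"
    and step: "\<And>q. Q p q \<Longrightarrow> \<exists>q'. proves \<Sigma> R q a q' \<and> Q p' q'"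
  shows "replay \<Sigma> R Q (\<lambda>M. True) p a p'"
  using assms(1)
proof (rule replayE)
  fix G :: "('f, 'v) marking \<Rightarrow> ('f, 'v) marking"
  assume mono: "\<And>M M'. M \<subseteq>\<^sub>m M' \<Longrightarrow> G M \<subseteq>\<^sub>m G M'"
    and good: "\<And>M. M [] = Some Open \<Longrightarrow> good Q p M \<Longrightarrow> good Q p' (G M)"
    and proves: "\<And>M. M [] = Some Open \<Longrightarrow> good Q p M \<Longrightarrow> proves \<Sigma> R (decode p M) a (decode p' (G M))"
  \<comment> \<open>The answer to a root mark \<open>q\<close> depends on \<open>q\<close> alone, so
    markings with the same root mark have the same image, as monotonicity demands.\<close>
  define c where "c = (\<lambda>q. SOME q'. proves \<Sigma> R q a q' \<and> Q p' q')"
  have c: "proves \<Sigma> R q a (c q) \<and> Q p' (c q)" if "Q p q" for q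
    unfolding c_def using someI_ex[OF step[OF that]] .
  \<comment> \<open>An undefined root makes a good marking empty, so the given proof serves
    unchanged; its empty image lies below whatever an extension may yield. A defined root label
    survives extension, so from then on the case stays the same.\<close>
  define F where "F = (\<lambda>M. case M [] of None \<Rightarrow> (\<lambda>\<pi>. None) | Some Open \<Rightarrow> G M | Some (Mark q) \<Rightarrow> [[] \<mapsto> Mark (c q)])"
  have F_None: "F M = (\<lambda>\<pi>. None)" if "M [] = None" for M using that by (simp add: F_def)
  have F_Open: "F M = G M" if "M [] = Some Open" for M using that by (simp add: F_def)
  have F_Mark: "F M = [[] \<mapsto> Mark (c q)]" if "M [] = Some (Mark q)" for M q using that by (simp add: F_def)
  have root: "M [] = None \<or> M [] = Some Open \<or> (\<exists>q. M [] = Some (Mark q))" for M :: "('f, 'v) marking"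
    by (metis lab.exhaust not_None_eq)
  show ?thesis
  proof (rule replayI)
    fix M M' :: "('f, 'v) marking" assume le: "M \<subseteq>\<^sub>m M'"
    from root[of M] show "F M \<subseteq>\<^sub>m F M'"
    proof (elim disjE exE)
      assume "M [] = None"
      then show ?thesis by (simp add: F_None)
    next
      assume "M [] = Some Open"
      moreover from map_leD[OF le this] have "M' [] = Some Open" .
      ultimately show ?thesis using mono[OF le] by (simp add: F_Open)
    next
      fix q assume "M [] = Some (Mark q)"
      moreover from map_leD[OF le this] have "M' [] = Some (Mark q)" .
      ultimately show ?thesis by (simp add: F_Mark)
    qed
  next
    fix M assume M: "good Q p M"
    from root[of M] show "good Q p' (F M)"
    proof (elim disjE exE)
      fix q assume q: "M [] = Some (Mark q)"
      from c[OF good_MarkD[OF M q]] show ?thesis by (simp add: F_Mark[of M, OF q] good_Mark)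
    qed (simp_all add: F_None F_Open good M)
    from root[of M] show "proves \<Sigma> R (decode p M) a (decode p' (F M))"
    proof (elim disjE exE)
      assume N: "M [] = None"
      from good_None[OF M this] have "decode p M = p" by simp
      then show ?thesis using assms(2) by (simp add: F_None[of M] N)
    next
      fix q assume q: "M [] = Some (Mark q)"
      from c[OF good_MarkD[OF M q]] show ?thesis by (simp add: F_Mark[of M, OF q] q)
    qed (simp_all add: F_Open proves M)
  qed
qed

text \<open>Shared by both rule forms, which differ in how \<open>B\<close> spreads a marking of the
  source instance over the variables. \<open>solve_premises\<close> completes \<open>B M\<close> at
  the targets; no variable of the source is a target, so the source instance is still
  \<open>decode (subst s \<sigma>) M\<close> and the same rule applies again.\<close>

lemma replay_rule:
  fixes \<Sigma> :: "('f \<times> nat) set" and R :: "('f, 'v, 'a) rule set"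
  assumes "(H, (s, a, t)) \<in> R" "tyft_tyxt_rule \<Sigma> (H, (s, a, t))"
    and \<sigma>: "\<And>v. \<sigma> v \<in> closed_trms \<Sigma>"
    and IH: "\<And>u b w. (u, b, w) \<in> H \<Longrightarrow> replay \<Sigma> R Q (\<lambda>M. True) (subst u \<sigma>) b (subst w \<sigma>)"
    and Q: "\<And>r q. Q r q \<Longrightarrow> r \<in> closed_trms \<Sigma> \<and> q \<in> closed_trms \<Sigma>"
    and B_mono: "\<And>M M' v. M \<subseteq>\<^sub>m M' \<Longrightarrow> B M v \<subseteq>\<^sub>m B M' v"
    and B_good: "\<And>M v. D M \<Longrightarrow> good Q (subst s \<sigma>) M \<Longrightarrow> good Q (\<sigma> v) (B M v)"
    and B_source: "\<And>M \<tau>. D M \<Longrightarrow> good Q (subst s \<sigma>) M \<Longrightarrow>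
      (\<And>v. v \<in> fv s \<Longrightarrow> \<tau> v = decode (\<sigma> v) (B M v)) \<Longrightarrow> subst s \<tau> = decode (subst s \<sigma>) M"
  shows "replay \<Sigma> R Q D (subst s \<sigma>) a (subst t \<sigma>)"
  using assms(2)
proof (rule tyft_tyxt_ruleE)
  assume target: "\<And>u b w. (u, b, w) \<in> H \<Longrightarrow> wf_trm \<Sigma> u \<and> (\<exists>y. w = Var y \<and> y \<notin> fv s)"
    and uniq: "\<And>h h'. h \<in> H \<Longrightarrow> h' \<in> H \<Longrightarrow> snd (snd h) = snd (snd h') \<Longrightarrow> h = h'"
  have IH': "replay \<Sigma> R Q (\<lambda>M. True) (subst u \<sigma>) b (\<sigma> y)" if "(u, b, Var y) \<in> H" for u b y
    using IH[OF that] by simp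
  have Q_fv: "fv r = {} \<and> fv q = {}" if "Q r q" for r q
    using Q[OF that] by (simp add: closed_trms_def)
  obtain E :: "('v \<Rightarrow> ('f, 'v) marking) \<Rightarrow> 'v \<Rightarrow> ('f, 'v) marking" where
    E_mono: "\<And>B B' v. (\<And>v. B v \<subseteq>\<^sub>m B' v) \<Longrightarrow> E B v \<subseteq>\<^sub>m E B' v"
    and E_id: "\<And>B v. (\<And>u b. (u, b, Var v) \<notin> H) \<Longrightarrow> E B v = B v"
    and E_good: "\<And>B v. (\<And>v. good Q (\<sigma> v) (B v)) \<Longrightarrow> good Q (\<sigma> v) (E B v)"
    and E_proves: "\<And>B u b y. (\<And>v. good Q (\<sigma> v) (B v)) \<Longrightarrow> (u, b, Var y) \<in> H \<Longrightarrow>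
           proves \<Sigma> R (subst u (\<lambda>v. decode (\<sigma> v) (E B v))) b (decode (\<sigma> y) (E B y))"
    by (rule solve_premises[OF uniq IH' Q_fv]) blast+
  show ?thesis
  proof (rule replayI[where F = "\<lambda>M. graft t (\<lambda>\<pi>. None) (E (B M))"])
    fix M M' :: "('f, 'v) marking" assume "M \<subseteq>\<^sub>m M'"
    then show "graft t (\<lambda>\<pi>. None) (E (B M)) \<subseteq>\<^sub>m graft t (\<lambda>\<pi>. None) (E (B M'))"
      by (intro graft_mono E_mono B_mono) simp_all
  next
    fix M assume M: "D M" "good Q (subst s \<sigma>) M"
    let ?\<tau> = "\<lambda>v. decode (\<sigma> v) (E (B M) v)"
    have good: "good Q (\<sigma> v) (E (B M) v)" for v
      by (rule E_good) (rule B_good[OF M])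
    then show "good Q (subst t \<sigma>) (graft t (\<lambda>\<pi>. None) (E (B M)))"
      by (intro good_graft) simp_all
    have "?\<tau> v \<in> closed_trms \<Sigma>" for v
      by (rule decode_closed_trms[OF good]) (simp_all add: Q \<sigma>)
    moreover have "proves \<Sigma> R (subst u ?\<tau>) b (subst w ?\<tau>)" if h: "(u, b, w) \<in> H" for u b w
    proof -
      from target[OF h] obtain y where "w = Var y" by blast
      with h E_proves[of "B M" u b y] B_good[OF M] show ?thesis by simp
    qed
    ultimately have "proves \<Sigma> R (subst s ?\<tau>) a (subst t ?\<tau>)"
      by (rule proves.rule[OF assms(1)])
    moreover have "subst s ?\<tau> = decode (subst s \<sigma>) M"
    proof (rule B_source[OF M])
      fix v assume "v \<in> fv s"
      then have "E (B M) v = B M v" using target by (intro E_id) fastforce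
      then show "?\<tau> v = decode (\<sigma> v) (B M v)" by simp
    qed
    moreover have "subst t ?\<tau> = decode (subst t \<sigma>) (graft t (\<lambda>\<pi>. None) (E (B M)))"
      using decode_graft[of Q t "\<lambda>\<pi>. None" \<sigma> "E (B M)"] Q_fv by simp
    ultimately show "proves \<Sigma> R (decode (subst s \<sigma>) M) a (decode (subst t \<sigma>) (graft t (\<lambda>\<pi>. None) (E (B M))))"
      by simp
  qed
qed

text \<open>A marking of the instance is a marking of the value of \<open>x\<close>, so even a mark
  at the root merely changes that value and all markings can be treated.\<close>

lemma replay_tyxt:
  assumes "(H, (Var x, a, t)) \<in> R" "tyft_tyxt_rule \<Sigma> (H, (Var x, a, t))"
    and "\<And>v. \<sigma> v \<in> closed_trms \<Sigma>"
    and "\<And>u b w. (u, b, w) \<in> H \<Longrightarrow> replay \<Sigma> R Q (\<lambda>M. True) (subst u \<sigma>) b (subst w \<sigma>)"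
    and "\<And>r q. Q r q \<Longrightarrow> r \<in> closed_trms \<Sigma> \<and> q \<in> closed_trms \<Sigma>"
  shows "replay \<Sigma> R Q (\<lambda>M. True) (subst (Var x) \<sigma>) a (subst t \<sigma>)"
  by (rule replay_rule[OF assms, where B = "\<lambda>M v. if v = x then M else (\<lambda>\<pi>. None)"]) auto

text \<open>A mark at the root could remove the function symbol, hence the restriction to
  \<open>Open\<close>. The marking then splits into markings of the arguments, and since
  \<open>xs\<close> is distinct these can be assigned to the variables independently.\<close>

lemma replay_tyft:
  fixes \<Sigma> :: "('f \<times> nat) set" and R :: "('f, 'v, 'a) rule set"
  assumes "(H, (Fun f (map Var xs), a, t)) \<in> R" "tyft_tyxt_rule \<Sigma> (H, (Fun f (map Var xs), a, t))"
    and "\<And>v. \<sigma> v \<in> closed_trms \<Sigma>"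
    and "\<And>u b w. (u, b, w) \<in> H \<Longrightarrow> replay \<Sigma> R Q (\<lambda>M. True) (subst u \<sigma>) b (subst w \<sigma>)"
    and "\<And>r q. Q r q \<Longrightarrow> r \<in> closed_trms \<Sigma> \<and> q \<in> closed_trms \<Sigma>"
    and "distinct xs"
  shows "replay \<Sigma> R Q (\<lambda>M. M [] = Some Open) (subst (Fun f (map Var xs)) \<sigma>) a (subst t \<sigma>)"
proof -
  define idx where "idx = the_inv_into {..<length xs} ((!) xs)"
  have idx: "idx (xs ! i) = i" if "i < length xs" for i
    unfolding idx_def using assms(6) that by (intro the_inv_into_f_f) (auto simp: inj_on_nth)
  show ?thesis
  proof (rule replay_rule[OF assms(1-5), where B = "\<lambda>M v. if v \<in> set xs then below M (Inr (idx v)) else (\<lambda>\<pi>. None)"])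
    fix M v assume M: "good Q (subst (Fun f (map Var xs)) \<sigma>) M"
    show "good Q (\<sigma> v) (if v \<in> set xs then below M (Inr (idx v)) else (\<lambda>\<pi>. None))"
    proof (cases "v \<in> set xs")
      case True
      then obtain i where i: "i < length xs" "v = xs ! i" by (auto simp: in_set_conv_nth)
      with good_below[OF M, of "Inr i" "\<sigma> v"] show ?thesis by (simp add: idx)
    qed simp
  next
    fix M \<tau> assume M: "M [] = Some Open"
      and \<tau>: "\<And>v. v \<in> fv (Fun f (map Var xs)) \<Longrightarrow>
        \<tau> v = decode (\<sigma> v) (if v \<in> set xs then below M (Inr (idx v)) else (\<lambda>\<pi>. None))"
    have "\<tau> (xs ! i) = decode (\<sigma> (xs ! i)) (below M (Inr i))" if "i < length xs" for i
      using \<tau>[of "xs ! i"] that by (simp add: idx)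
    then have "map \<tau> xs = map (\<lambda>i. decode (map \<sigma> xs ! i) (below M (Inr i))) [0..<length xs]"
      by (intro nth_equalityI) simp_all
    then show "subst (Fun f (map Var xs)) \<tau> = decode (subst (Fun f (map Var xs)) \<sigma>) M"
      by (simp add: decode_Fun M comp_def)
  next
    fix M M' :: "('f, 'v) marking" and v assume "M \<subseteq>\<^sub>m M'"
    then show "(if v \<in> set xs then below M (Inr (idx v)) else (\<lambda>\<pi>. None)) \<subseteq>\<^sub>m
        (if v \<in> set xs then below M' (Inr (idx v)) else (\<lambda>\<pi>. None))"
      using map_le_below[of M M' "Inr (idx v)"] by (cases "v \<in> set xs") simp_all
  qed
qed

abbreviation unfold_rec :: "'v \<Rightarrow> ('v \<Rightarrow> ('f, 'v) trm option) \<Rightarrow> ('f, 'v) trm" where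
  "unfold_rec X S \<equiv> subst (the (S X)) (\<lambda>Y. if Y \<in> dom S then Rec Y S else Var Y)"

text \<open>With an open root, \<open>M\<close> describes a change of the bodies and turns
  \<open>S\<close> into a specification \<open>S'\<close>. In the unfolding this affects the body of
  \<open>X\<close> and every copy of \<open>S\<close> substituted into it, so \<open>M\<close> is
  used both below \<open>Inl X\<close> and at each recursion variable; the result decodes to the
  unfolding of \<open>S'\<close>.\<close>

lemma replay_recursion:
  fixes \<Sigma> :: "('f \<times> nat) set" and R :: "('f, 'v, 'a) rule set"
  assumes closed: "Rec X S \<in> closed_trms \<Sigma>"
    and IH: "replay \<Sigma> R Q (\<lambda>M. True) (unfold_rec X S) a p'"
    and Q: "\<And>r q. Q r q \<Longrightarrow> r \<in> closed_trms \<Sigma> \<and> q \<in> closed_trms \<Sigma>"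
  shows "replay \<Sigma> R Q (\<lambda>M. M [] = Some Open) (Rec X S) a p'"
  using IH
proof (rule replayE)
  fix F :: "('f, 'v) marking \<Rightarrow> ('f, 'v) marking"
  assume mono: "\<And>M M'. M \<subseteq>\<^sub>m M' \<Longrightarrow> F M \<subseteq>\<^sub>m F M'"
    and good: "\<And>M. True \<Longrightarrow> good Q (unfold_rec X S) M \<Longrightarrow> good Q p' (F M)"
    and proves: "\<And>M. True \<Longrightarrow> good Q (unfold_rec X S) M \<Longrightarrow>
      proves \<Sigma> R (decode (unfold_rec X S) M) a (decode p' (F M))"
  from closed obtain t where t: "S X = Some t" by (auto simp: closed_trms_def wf_trm_Rec)
  define N where "N = (\<lambda>M :: ('f, 'v) marking. graft t (below M (Inl X)) (\<lambda>Y. if Y \<in> dom S then M else (\<lambda>\<pi>. None)))"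
  show ?thesis
  proof (rule replayI[where F = "\<lambda>M. F (N M)"])
    fix M M' :: "('f, 'v) marking" assume "M \<subseteq>\<^sub>m M'"
    then show "F (N M) \<subseteq>\<^sub>m F (N M')"
      unfolding N_def by (intro mono graft_mono map_le_below) simp_all
  next
    fix M :: "('f, 'v) marking" assume M: "M [] = Some Open" "good Q (Rec X S) M"
    have 1: "good Q t (below M (Inl X))" using good_below[OF M(2)] t by simp
    \<comment> \<open>All terms \<open>Rec Y S\<close> have the same children, and an
      \<open>Open\<close> root label does not mention the term itself.\<close>
    have 2: "good Q (Rec Y S) M" for Y
    proof (rule good_Open[where M = M, OF M(1)])
      fix d c assume "child (Rec Y S) d = Some c"
      then have "child (Rec X S) d = Some c" by (cases d) simp_all
      then show "good Q c (below M d)" by (rule good_below[OF M(2)])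
    next
      fix d \<pi> assume "child (Rec Y S) d = None"
      then have "child (Rec X S) d = None" by (cases d) simp_all
      then show "M (d # \<pi>) = None" by (rule good_below_None[OF M(2)])
    qed
    have N: "good Q (unfold_rec X S) (N M)"
      unfolding N_def t option.sel by (rule good_graft[OF 1]) (simp add: 2)
    then show "good Q p' (F (N M))" using good by simp
    define S' where "S' = (\<lambda>Y. map_option (\<lambda>t. decode t (below M (Inl Y))) (S Y))"
    have dom: "dom S' = dom S" by (auto simp: S'_def dom_def)
    have S': "decode (Rec Y S) M = Rec Y S'" for Y by (simp add: decode_Rec M(1) S'_def)
    have "decode (unfold_rec X S) (N M) = unfold_rec X S'"
    proof -
      have "Q r q \<Longrightarrow> fv r = {} \<and> fv q = {}" for r q using Q[of r q] by (simp add: closed_trms_def)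
      then have "decode (unfold_rec X S) (N M) = subst (decode t (below M (Inl X)))
          (\<lambda>v. decode (if v \<in> dom S then Rec v S else Var v) (if v \<in> dom S then M else (\<lambda>\<pi>. None)))"
        unfolding N_def t option.sel by (rule decode_graft[OF 1])
      also have "(\<lambda>v. decode (if v \<in> dom S then Rec v S else Var v) (if v \<in> dom S then M else (\<lambda>\<pi>. None)))
          = (\<lambda>v. if v \<in> dom S' then Rec v S' else Var v)"
        by (simp add: fun_eq_iff dom S')
      also have "decode t (below M (Inl X)) = the (S' X)" by (simp add: S'_def t)
      finally show ?thesis .
    qed
    with proves[OF _ N] have "proves \<Sigma> R (unfold_rec X S') a (decode p' (F (N M)))" by simp
    moreover have "Rec X S' \<in> closed_trms \<Sigma>"
      using decode_closed_trms[OF M(2), of \<Sigma>] Q closed S' by simp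
    ultimately show "proves \<Sigma> R (decode (Rec X S) M) a (decode p' (F (N M)))"
      unfolding S' by (intro proves.recursion)
  qed
qed

text \<open>Induction on the proof. \<open>step\<close> is offered what the induction has reached:
  replay of the present transition for open roots and, for a recursion, full replay of its
  unfolding. A relation \<open>Q\<close> not yet known to be a simulation can use these facts to
  answer a root mark.\<close>

lemma replay_proves:
  assumes format: "\<forall>r \<in> R. tyft_tyxt_rule \<Sigma> r"
    and Q: "\<And>r q. Q r q \<Longrightarrow> r \<in> closed_trms \<Sigma> \<and> q \<in> closed_trms \<Sigma>"
    and step: "\<And>p a p' q. proves \<Sigma> R p a p' \<Longrightarrow> replay \<Sigma> R Q (\<lambda>M. M [] = Some Open) p a p' \<Longrightarrow>
      (\<And>X S. p = Rec X S \<Longrightarrow> replay \<Sigma> R Q (\<lambda>M. True) (unfold_rec X S) a p') \<Longrightarrow>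
      Q p q \<Longrightarrow> \<exists>q'. proves \<Sigma> R q a q' \<and> Q p' q'"
    and "proves \<Sigma> R p a p'"
  shows "replay \<Sigma> R Q (\<lambda>M. True) p a p'"
  using assms(4)
proof induction
  case (rule H s a t \<sigma>)
  from rule.hyps(1) format have fmt: "tyft_tyxt_rule \<Sigma> (H, (s, a, t))" by blast
  then have "(\<exists>x. s = Var x) \<or> (\<exists>f xs. s = Fun f (map Var xs) \<and> distinct xs)"
    by (rule tyft_tyxt_ruleE)
  then show ?case
  proof (elim disjE exE conjE)
    fix x assume s: "s = Var x"
    show ?thesis
      unfolding s by (rule replay_tyxt[OF rule.hyps(1)[unfolded s] fmt[unfolded s] rule.hyps(2) rule.IH Q])
  next
    fix f xs assume s: "s = Fun f (map Var xs)" "distinct xs"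
    have "proves \<Sigma> R (subst s \<sigma>) a (subst t \<sigma>)"
      by (rule proves.rule[OF rule.hyps(1,2)]) (rule rule.hyps(3))
    moreover have "replay \<Sigma> R Q (\<lambda>M. M [] = Some Open) (subst s \<sigma>) a (subst t \<sigma>)"
      unfolding s(1)
      by (rule replay_tyft[OF rule.hyps(1)[unfolded s(1)] fmt[unfolded s(1)] rule.hyps(2) rule.IH Q s(2)])
    ultimately show ?thesis
      using step[of "subst s \<sigma>" a "subst t \<sigma>"] s(1) by (intro replay_of_open) simp_all
  qed
next
  case (recursion X S a q)
  have "proves \<Sigma> R (Rec X S) a q" by (rule proves.recursion[OF recursion.hyps])
  moreover have "replay \<Sigma> R Q (\<lambda>M. M [] = Some Open) (Rec X S) a q"
    by (rule replay_recursion[OF recursion.hyps(1) recursion.IH Q])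
  ultimately show ?case
    using step[of "Rec X S" a q] recursion.IH by (intro replay_of_open) simp_all
qed

section \<open>Congruence\<close>

lemma replay_step:
  assumes "replay \<Sigma> R Q D p a p'" "D M" "good Q p M"
  obtains M' where "good Q p' M'" "proves \<Sigma> R (decode p M) a (decode p' M')"
  using assms(1) by (rule replayE) (use assms(2,3) that in blast)

text \<open>Replacing closed subterms by bisimilar ones is itself a bisimulation:
  \<open>decode_symmetric\<close> gives symmetry, and in \<open>replay_proves\<close> a mark at the
  root is answered by bisimilarity.\<close>

lemma bisimilar_decode:
  assumes format: "\<forall>r \<in> R. tyft_tyxt_rule \<Sigma> r"
    and "p \<in> closed_trms \<Sigma>" "good (bisimilar \<Sigma> R) p M"
  shows "bisimilar \<Sigma> R p (decode p M)"
proof (rule bisimilarI)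
  let ?Q = "bisimilar \<Sigma> R"
  let ?B = "{(p, decode p M) | p M. p \<in> closed_trms \<Sigma> \<and> good ?Q p M}"
  show "bisimulation \<Sigma> R ?B"
    unfolding bisimulation_def
  proof (intro conjI allI impI)
    show "?B \<subseteq> closed_trms \<Sigma> \<times> closed_trms \<Sigma>"
      using decode_closed_trms[of ?Q] bisimilar_closed_trms by blast
    show "sym ?B"
    proof (rule symI)
      fix p q assume "(p, q) \<in> ?B"
      then obtain M where M: "p \<in> closed_trms \<Sigma>" "good ?Q p M" "q = decode p M" by blast
      from M(2) bisimilar_sym obtain N where "good ?Q q N" "decode q N = p"
        unfolding M(3) by (rule decode_symmetric)
      moreover have "q \<in> closed_trms \<Sigma>"
        unfolding M(3) using decode_closed_trms[OF M(2) _ M(1)] bisimilar_closed_trms by blast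
      ultimately show "(q, p) \<in> ?B" by blast
    qed
    fix p q a p' assume "(p, q) \<in> ?B \<and> proves \<Sigma> R p a p'"
    then obtain M where M: "good ?Q p M" "q = decode p M" and p: "proves \<Sigma> R p a p'" by blast
    have "replay \<Sigma> R ?Q (\<lambda>M. True) p a p'"
    proof (rule replay_proves[OF format bisimilar_closed_trms _ p])
      fix p a p' q assume "proves \<Sigma> R p a p'" "?Q p q"
      then show "\<exists>q'. proves \<Sigma> R q a q' \<and> ?Q p' q'" by (meson bisimilar_step)
    qed
    then obtain M' where "good ?Q p' M'" "proves \<Sigma> R q a (decode p' M')"
      unfolding M(2) by (rule replay_step[OF _ TrueI M(1)])
    then show "\<exists>q'. proves \<Sigma> R q a q' \<and> (p', q') \<in> ?B"
      using proves_closed_trms[OF format p] by blast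
  qed
qed (use assms in blast)

text \<open>The marks in \<open>plug\<close> are related by the closure itself rather than by
  \<open>B\<close>, so the closure is stable under \<open>decode\<close> by construction.\<close>

inductive contextual :: "('f \<times> nat) set \<Rightarrow> (('f, 'v) trm \<Rightarrow> ('f, 'v) trm \<Rightarrow> bool) \<Rightarrow>
    ('f, 'v) trm \<Rightarrow> ('f, 'v) trm \<Rightarrow> bool"
  for \<Sigma> :: "('f \<times> nat) set" and B :: "('f, 'v) trm \<Rightarrow> ('f, 'v) trm \<Rightarrow> bool" where
  base: "B p q \<Longrightarrow> contextual \<Sigma> B p q"
| plug: "p \<in> closed_trms \<Sigma> \<Longrightarrow> good (contextual \<Sigma> B) p M \<Longrightarrow> contextual \<Sigma> B p (decode p M)"

lemma contextual_refl: "p \<in> closed_trms \<Sigma> \<Longrightarrow> contextual \<Sigma> B p p"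
  using contextual.plug[OF _ good_empty, of p \<Sigma> B] by simp

lemma good_conjD:
  assumes "good (\<lambda>p q. Q p q \<and> Q' p q) p M"
  shows "good Q p M" "good Q' p M"
  by (rule good_mono[THEN mp, OF _ assms], simp)+

lemma contextual_closed_trms:
  assumes "\<And>p q. B p q \<Longrightarrow> p \<in> closed_trms \<Sigma> \<and> q \<in> closed_trms \<Sigma>" "contextual \<Sigma> B p q"
  shows "p \<in> closed_trms \<Sigma> \<and> q \<in> closed_trms \<Sigma>"
  using assms(2)
proof induction
  case (plug p M)
  have "decode p M \<in> closed_trms \<Sigma>"
    by (rule decode_closed_trms[OF good_conjD(2)[OF plug(2)] _ plug(1)]) simp
  with plug(1) show ?case by simp
qed (rule assms(1))

lemma contextual_sym:
  assumes B: "\<And>p q. B p q \<Longrightarrow> p \<in> closed_trms \<Sigma> \<and> q \<in> closed_trms \<Sigma>"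
    and sym: "\<And>p q. B p q \<Longrightarrow> B q p" and "contextual \<Sigma> B p q"
  shows "contextual \<Sigma> B q p"
  using assms(3)
proof induction
  case (base p q)
  show ?case by (rule contextual.base) (rule sym[OF base])
next
  case (plug p M)
  \<comment> \<open>The induction hypothesis provides each mark in both directions. This conjunction
    is symmetric, as \<open>decode_symmetric\<close> requires, and one half of it is what
    \<open>plug\<close> needs.\<close>
  let ?C = "\<lambda>p q. contextual \<Sigma> B p q \<and> contextual \<Sigma> B q p"
  have swap: "?C q p" if "?C p q" for p q using that by (rule conj_commute[THEN iffD1])
  obtain N where N: "good ?C (decode p M) N" "decode (decode p M) N = p"
    by (rule decode_symmetric[OF plug(2) swap])
  have "q \<in> closed_trms \<Sigma>" if "contextual \<Sigma> B p q \<and> contextual \<Sigma> B q p" for p q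
    using contextual_closed_trms[of B \<Sigma>, OF B conjunct1[OF that]] by simp
  from decode_closed_trms[OF plug(2) this plug(1)] have "decode p M \<in> closed_trms \<Sigma>" .
  from contextual.plug[OF this good_conjD(1)[OF N(1)]] show ?case unfolding N(2) .
qed

text \<open>
  Bisimilarity is composed on the right only: the simulation argument is an induction on the proof of
  the left-hand transition, and a step to a bisimilar term on the left would lose that proof.
\<close>

definition contextual_bisimilar where
  "contextual_bisimilar \<Sigma> R B p q \<longleftrightarrow> (\<exists>r. contextual \<Sigma> B p r \<and> bisimilar \<Sigma> R r q)"

text \<open>Between a subterm \<open>r\<close> and its mark \<open>q\<close> lies a term
  contextually related to \<open>r\<close> and bisimilar to \<open>q\<close>. Marking with these
  terms first gives a contextual step; exchanging them for the marks \<open>q\<close> at the same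
  positions is covered by \<open>bisimilar_decode\<close>, and \<open>decode_remark\<close> merges
  the two.\<close>

lemma contextual_bisimilar_decode:
  assumes format: "\<forall>r \<in> R. tyft_tyxt_rule \<Sigma> r"
    and B: "\<And>p q. B p q \<Longrightarrow> p \<in> closed_trms \<Sigma> \<and> q \<in> closed_trms \<Sigma>"
    and p: "p \<in> closed_trms \<Sigma>" and M: "good (contextual_bisimilar \<Sigma> R B) p M"
  shows "contextual_bisimilar \<Sigma> R B p (decode p M)"
proof -
  let ?P = "\<lambda>\<pi> r. contextual \<Sigma> B (the (subat p \<pi>)) r \<and> (\<forall>q. M \<pi> = Some (Mark q) \<longrightarrow> bisimilar \<Sigma> R r q)"
  define h where "h = (\<lambda>\<pi>. SOME r. ?P \<pi> r)"
  have h: "contextual \<Sigma> B r (h \<pi>) \<and> bisimilar \<Sigma> R (h \<pi>) q"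
    if "subat p \<pi> = Some r" "M \<pi> = Some (Mark q)" "contextual_bisimilar \<Sigma> R B r q" for \<pi> r q
  proof -
    from that have "\<exists>r. ?P \<pi> r" unfolding contextual_bisimilar_def by simp
    from someI_ex[OF this] that show ?thesis unfolding h_def by simp
  qed
  define N where "N = remark M h"
  have N: "good (contextual \<Sigma> B) p N"
    unfolding N_def by (rule good_remark[OF M]) (use h in blast)
  have C: "contextual \<Sigma> B p (decode p N)" by (rule contextual.plug[OF p N])
  \<comment> \<open>Reads off the marks of \<open>M\<close>; the default is harmless because
    \<open>remark\<close> consults \<open>g\<close> at marked positions only.\<close>
  define g where "g = (\<lambda>\<pi>. case M \<pi> of Some (Mark q) \<Rightarrow> q | _ \<Rightarrow> undefined)"
  have M_eq: "M = remark N g"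
  proof
    fix \<pi> show "M \<pi> = remark N g \<pi>"
      by (cases "M \<pi>"; cases "the (M \<pi>)") (auto simp: remark_def N_def g_def)
  qed
  have "good (bisimilar \<Sigma> R) (decode p N) (remark N g)"
  proof (rule good_remark_decode[OF N])
    fix \<pi> r s assume r: "subat p \<pi> = Some r" and s: "N \<pi> = Some (Mark s)"
    from s obtain q where q: "M \<pi> = Some (Mark q)" "s = h \<pi>"
      unfolding N_def by (cases rule: remark_cases[of M \<pi> h]) auto
    from M q(1) r have "contextual_bisimilar \<Sigma> R B r q" by (auto elim: good_subat)
    from h[OF r q(1) this] show "bisimilar \<Sigma> R s (g \<pi>)" by (simp add: q g_def)
  qed
  then have "bisimilar \<Sigma> R (decode p N) (decode (decode p N) (remark N g))"
    using contextual_closed_trms[OF B C] by (intro bisimilar_decode[OF format]) simp_all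
  then have "bisimilar \<Sigma> R (decode p N) (decode p M)"
    unfolding decode_remark by (simp only: M_eq[symmetric])
  with C show ?thesis unfolding contextual_bisimilar_def by blast
qed

text \<open>\<open>B_rec\<close> is an up-to condition: the unfolding of the left term, after
  replacement of subterms related by \<open>contextual_bisimilar\<close>, is bisimilar to the
  unfolding of the right one. It suffices because \<open>replay_proves\<close> has already handled
  the smaller proof of the unfolding's transition.\<close>

lemma contextual_bisimilar_step:
  fixes \<Sigma> :: "('f \<times> nat) set" and R :: "('f, 'v, 'a) rule set"
  assumes format: "\<forall>r \<in> R. tyft_tyxt_rule \<Sigma> r"
    and B: "\<And>p q. B p q \<Longrightarrow> p \<in> closed_trms \<Sigma> \<and> q \<in> closed_trms \<Sigma>"
    and B_rec: "\<And>p q. B p q \<Longrightarrow> \<exists>X S S' M. p = Rec X S \<and> q = Rec X S' \<and>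
        good (contextual_bisimilar \<Sigma> R B) (unfold_rec X S) M \<and>
        bisimilar \<Sigma> R (decode (unfold_rec X S) M) (unfold_rec X S')"
    and "contextual_bisimilar \<Sigma> R B p q" "proves \<Sigma> R p a p'"
  obtains q' where "proves \<Sigma> R q a q'" "contextual_bisimilar \<Sigma> R B p' q'"
proof -
  let ?Q = "contextual_bisimilar \<Sigma> R B"
  have closed: "p \<in> closed_trms \<Sigma> \<and> q \<in> closed_trms \<Sigma>" if "?Q p q" for p q
    using that contextual_closed_trms[of B \<Sigma>, OF B] bisimilar_closed_trms
    unfolding contextual_bisimilar_def by blast
  have trans: "?Q p r" if "?Q p q" "bisimilar \<Sigma> R q r" for p q r
    using that bisimilar_trans unfolding contextual_bisimilar_def by blast
  have sub: "?Q p q" if "contextual \<Sigma> B p q" for p q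
    using that bisimilar_refl[OF format] contextual_closed_trms[of B \<Sigma>, OF B]
    unfolding contextual_bisimilar_def by blast
  have step: "\<exists>q'. proves \<Sigma> R q a q' \<and> ?Q p' q'"
    if p: "proves \<Sigma> R p a p'" "replay \<Sigma> R ?Q (\<lambda>M. M [] = Some Open) p a p'"
      "\<And>X S. p = Rec X S \<Longrightarrow> replay \<Sigma> R ?Q (\<lambda>M. True) (unfold_rec X S) a p'" and "?Q p q"
    for p a p' q
  proof -
    from \<open>?Q p q\<close> obtain r where r: "contextual \<Sigma> B p r" "bisimilar \<Sigma> R r q"
      unfolding contextual_bisimilar_def by blast
    have p': "p' \<in> closed_trms \<Sigma>" using proves_closed_trms[OF format p(1)] by simp
    from r(1) p have "\<exists>r'. proves \<Sigma> R r a r' \<and> ?Q p' r'"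
    \<comment> \<open>Induction on the contextual closure with \<open>p'\<close> fixed; the replay
      facts about the left term travel along as premises, since a root mark keeps the left
      term.\<close>
    proof induction
      case (base p q)
      from B_rec[OF base(1)] obtain X S S' M where M: "p = Rec X S" "q = Rec X S'"
        "good ?Q (unfold_rec X S) M" "bisimilar \<Sigma> R (decode (unfold_rec X S) M) (unfold_rec X S')" by blast
      from base.prems(3)[OF M(1)] obtain M' where
        M': "good ?Q p' M'" "proves \<Sigma> R (decode (unfold_rec X S) M) a (decode p' M')"
        by (rule replay_step[OF _ TrueI M(3)])
      from M(4) M'(2) obtain r' where r': "proves \<Sigma> R (unfold_rec X S') a r'" "bisimilar \<Sigma> R (decode p' M') r'"
        by (rule bisimilar_step)
      have "proves \<Sigma> R q a r'" unfolding M(2)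
        by (rule proves.recursion) (use r' B[OF base(1)] M(2) in simp_all)
      moreover have "?Q p' r'"
        by (rule trans[OF contextual_bisimilar_decode[OF format B p' M'(1)] r'(2)])
      ultimately show ?case by blast
    next
      case (plug p M)
      note M = good_conjD[OF plug(2)]
      from M(1) have good: "good ?Q p M"
        using good_mono[of "contextual \<Sigma> B" ?Q p M] sub by blast
      have "M [] = None \<or> M [] = Some Open \<or> (\<exists>r. M [] = Some (Mark r))"
        by (metis lab.exhaust not_None_eq)
      then show ?case
      proof (elim disjE exE)
        assume "M [] = None"
        from good_None[OF good this] have "decode p M = p" by simp
        with plug.prems(1) sub[OF contextual_refl[OF p']] show ?thesis by auto
      next
        assume "M [] = Some Open"
        with plug.prems(2) obtain M' where
          "good ?Q p' M'" "proves \<Sigma> R (decode p M) a (decode p' M')"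
          using good by (elim replay_step)
        with contextual_bisimilar_decode[OF format B p'] show ?thesis by blast
      next
        fix r assume r: "M [] = Some (Mark r)"
        \<comment> \<open>A root mark relates the whole of \<open>p\<close> to \<open>r\<close>, so
          the induction hypothesis for this pair gives the answer.\<close>
        from good_MarkD[OF plug(2) r] plug.prems have "\<exists>r'. proves \<Sigma> R r a r' \<and> ?Q p' r'" by blast
        then show ?thesis by (simp add: r)
      qed
    qed
    then obtain r' where r': "proves \<Sigma> R r a r'" "?Q p' r'" by blast
    from r(2) r'(1) obtain q' where "proves \<Sigma> R q a q'" "bisimilar \<Sigma> R r' q'" by (rule bisimilar_step)
    with trans[OF r'(2)] show ?thesis by blast
  qed
  have "replay \<Sigma> R ?Q (\<lambda>M. True) p a p'"
    by (rule replay_proves[OF format closed step assms(5)])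
  \<comment> \<open>The marking that replaces the whole of \<open>p\<close> decodes to
    \<open>q\<close>, which turns replay into a transition of \<open>q\<close>.\<close>
  then obtain M' where M': "good ?Q p' M'" "proves \<Sigma> R (decode p [[] \<mapsto> Mark q]) a (decode p' M')"
    by (rule replay_step[OF _ TrueI good_Mark[of ?Q, OF assms(4)]])
  have "?Q p' (decode p' M')"
    using proves_closed_trms[OF format assms(5)] M'(1)
    by (intro contextual_bisimilar_decode[OF format B]) simp_all
  with M'(2) show thesis by (intro that) simp_all
qed

section \<open>Equivalence and the two congruence properties\<close>

lemma equiv_bisimilar:
  assumes "\<forall>r \<in> R. tyft_tyxt_rule \<Sigma> r"
  shows "equiv (closed_trms \<Sigma>) {(p, q). bisimilar \<Sigma> R p q}"
proof (rule equivI)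
  show "{(p, q). bisimilar \<Sigma> R p q} \<subseteq> closed_trms \<Sigma> \<times> closed_trms \<Sigma>"
    using bisimilar_closed_trms[of \<Sigma> R] by blast
  show "refl_on (closed_trms \<Sigma>) {(p, q). bisimilar \<Sigma> R p q}"
    using bisimilar_refl[OF assms] by (simp add: refl_on_def)
  show "sym {(p, q). bisimilar \<Sigma> R p q}"
    using bisimilar_sym[of \<Sigma> R] by (simp add: sym_def)
  show "trans {(p, q). bisimilar \<Sigma> R p q}"
    using bisimilar_trans[of \<Sigma> R] unfolding trans_def by blast
qed

text \<open>An instance of \<open>bisimilar_decode\<close>, for the marking with an
  \<open>Open\<close> root and a mark at each argument.\<close>

lemma bisimilar_Fun:
  fixes \<Sigma> :: "('f \<times> nat) set" and R :: "('f, 'v, 'a) rule set"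
  assumes format: "\<forall>r \<in> R. tyft_tyxt_rule \<Sigma> r"
    and f: "(f, length ps) \<in> \<Sigma>" and ps: "list_all2 (bisimilar \<Sigma> R) ps qs"
  shows "bisimilar \<Sigma> R (Fun f ps) (Fun f qs)"
proof -
  have len: "length ps = length qs" using ps by (rule list_all2_lengthD)
  have bis: "bisimilar \<Sigma> R (ps ! i) (qs ! i)" if "i < length ps" for i
    using ps that by (rule list_all2_nthD)
  have ps_closed: "p \<in> closed_trms \<Sigma>" if "p \<in> set ps" for p
    using that bis bisimilar_closed_trms[of \<Sigma> R] by (metis in_set_conv_nth)
  have closed: "Fun f ps \<in> closed_trms \<Sigma>"
    using f ps_closed by (auto simp: closed_trms_def list_all_iff)
  define M :: "('f, 'v) marking" where "M = (\<lambda>\<pi>. case \<pi> of [] \<Rightarrow> Some Open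
    | d # \<pi>' \<Rightarrow> (case d of Inl Y \<Rightarrow> None
        | Inr i \<Rightarrow> if i < length ps then [[] \<mapsto> Mark (qs ! i)] \<pi>' else None))"
  have M_Nil: "M [] = Some Open" by (simp add: M_def)
  have M_Inr: "below M (Inr i) = [[] \<mapsto> Mark (qs ! i)]" if "i < length ps" for i
    using that by (simp add: M_def fun_eq_iff)
  have "good (bisimilar \<Sigma> R) (Fun f ps) M"
  proof (rule good_Open[of M, OF M_Nil])
    fix d c assume "child (Fun f ps) d = Some c"
    then obtain i where "d = Inr i" "i < length ps" "c = ps ! i"
      by (cases d) (auto split: if_splits)
    then show "good (bisimilar \<Sigma> R) c (below M d)" by (simp add: M_Inr good_Mark bis)
  next
    fix d \<pi> assume "child (Fun f ps) d = None"
    then show "M (d # \<pi>) = None" by (cases d) (auto simp: M_def split: if_splits)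
  qed
  from bisimilar_decode[OF format closed this]
  have "bisimilar \<Sigma> R (Fun f ps) (decode (Fun f ps) M)" .
  moreover have "map (\<lambda>i. decode (ps ! i) (below M (Inr i))) [0..<length ps] = qs"
    by (rule nth_equalityI) (simp_all add: len M_Inr)
  ultimately show ?thesis by (simp add: decode_Fun M_Nil)
qed

text \<open>Replacing the copies of \<open>Rec v S\<close> that unfolding inserts by
  \<open>Rec v S'\<close> yields a body of \<open>S\<close> under the substitution of the terms
  \<open>Rec v S'\<close>. The assumption \<open>bis\<close>, taken at this substitution, makes it
  bisimilar to the unfolding of \<open>S'\<close>, which is the up-to condition of
  \<open>contextual_bisimilar_step\<close>.\<close>

lemma bisimilar_Rec:
  fixes \<Sigma> :: "('f \<times> nat) set" and R :: "('f, 'v, 'a) rule set"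
  assumes format: "\<forall>r \<in> R. tyft_tyxt_rule \<Sigma> r"
    and "X \<in> W" and dom: "dom S = W" "dom S' = W"
    and S: "\<And>Y. Y \<in> W \<Longrightarrow> the (S Y) \<in> trms_over \<Sigma> W"
    and S': "\<And>Y. Y \<in> W \<Longrightarrow> the (S' Y) \<in> trms_over \<Sigma> W"
    and bis: "\<And>Y \<sigma>. Y \<in> W \<Longrightarrow> (\<And>v. v \<in> W \<Longrightarrow> \<sigma> v \<in> closed_trms \<Sigma>) \<Longrightarrow>
      bisimilar \<Sigma> R (subst (the (S Y)) \<sigma>) (subst (the (S' Y)) \<sigma>)"
  shows "bisimilar \<Sigma> R (Rec X S) (Rec X S')"
proof -
  have closed: "Rec Y T \<in> closed_trms \<Sigma>"
    if "Y \<in> W" "dom T = W" and T: "\<And>Y. Y \<in> W \<Longrightarrow> the (T Y) \<in> trms_over \<Sigma> W" for Y T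
  proof -
    have "t \<in> trms_over \<Sigma> W" if "t \<in> ran T" for t
      using that T \<open>dom T = W\<close> by (force simp: ran_def)
    then show ?thesis using that(1,2) by (fastforce simp: closed_trms_def trms_over_def wf_trm_Rec fv_Rec)
  qed
  \<comment> \<open>Both orientations are included so that the contextual closure is
    symmetric.\<close>
  define B where "B = (\<lambda>p q. \<exists>Y \<in> W. p = Rec Y S \<and> q = Rec Y S' \<or> p = Rec Y S' \<and> q = Rec Y S)"
  let ?Q = "contextual_bisimilar \<Sigma> R B"
  have B_closed: "p \<in> closed_trms \<Sigma> \<and> q \<in> closed_trms \<Sigma>" if "B p q" for p q
    using that closed[OF _ dom(1) S] closed[OF _ dom(2) S'] unfolding B_def by blast
  have B_sym: "B q p" if "B p q" for p q
    using that unfolding B_def by blast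
  have B_Q: "?Q p q" if "B p q" for p q
    unfolding contextual_bisimilar_def
    using contextual.base[of B, OF that] bisimilar_refl[OF format] B_closed[OF that] by blast
  have unfold: "\<exists>M. good ?Q (unfold_rec Y T) M \<and> bisimilar \<Sigma> R (decode (unfold_rec Y T) M) (unfold_rec Y T')"
    if "Y \<in> W" and T: "dom T = W" "dom T' = W"
      and T': "\<And>Y. Y \<in> W \<Longrightarrow> the (T' Y) \<in> trms_over \<Sigma> W"
      and "\<And>Y. Y \<in> W \<Longrightarrow> B (Rec Y T) (Rec Y T')"
      and bis: "\<And>\<sigma>. (\<And>v. v \<in> W \<Longrightarrow> \<sigma> v \<in> closed_trms \<Sigma>) \<Longrightarrow>
        bisimilar \<Sigma> R (subst (the (T Y)) \<sigma>) (subst (the (T' Y)) \<sigma>)" for Y T T'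
  proof (intro exI conjI)
    let ?m = "\<lambda>v. if v \<in> W then [[] \<mapsto> Mark (Rec v T')] else (\<lambda>\<pi>. None)"
    let ?M = "graft (the (T Y)) (\<lambda>\<pi>. None) ?m"
    have "good ?Q (if v \<in> W then Rec v T else Var v) (?m v)" for v
      using B_Q[OF that(5), of v] by (simp add: good_Mark)
    then show "good ?Q (unfold_rec Y T) ?M"
      unfolding T by (intro good_graft) simp_all
    have "fv r = {} \<and> fv q = {}" if "?Q r q" for r q
    proof -
      from that obtain s where s: "contextual \<Sigma> B r s" "bisimilar \<Sigma> R s q"
        unfolding contextual_bisimilar_def by blast
      show ?thesis
        using contextual_closed_trms[of B, OF B_closed s(1)] bisimilar_closed_trms[OF s(2)]
        by (simp add: closed_trms_def)
    qed
    then have "decode (unfold_rec Y T) ?M = subst (decode (the (T Y)) (\<lambda>\<pi>. None))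
        (\<lambda>v. decode (if v \<in> W then Rec v T else Var v) (?m v))"
      unfolding T by (rule decode_graft[OF good_empty])
    also have "(\<lambda>v. decode (if v \<in> W then Rec v T else Var v) (?m v)) = (\<lambda>v. if v \<in> W then Rec v T' else Var v)"
      by (simp add: fun_eq_iff)
    finally show "bisimilar \<Sigma> R (decode (unfold_rec Y T) ?M) (unfold_rec Y T')"
      using bis[of "\<lambda>v. if v \<in> W then Rec v T' else Var v"] closed[OF _ T(2) T'] T(2) by simp
  qed
  have B_rec: "\<exists>X S S' M. p = Rec X S \<and> q = Rec X S' \<and> good ?Q (unfold_rec X S) M \<and>
      bisimilar \<Sigma> R (decode (unfold_rec X S) M) (unfold_rec X S')" if "B p q" for p q
  proof -
    from that obtain Y where Y: "Y \<in> W" "p = Rec Y S \<and> q = Rec Y S' \<or> p = Rec Y S' \<and> q = Rec Y S"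
      unfolding B_def by blast
    have B1: "B (Rec Y S) (Rec Y S')" "B (Rec Y S') (Rec Y S)" if "Y \<in> W" for Y
      using that unfolding B_def by blast+
    from Y(2) show ?thesis
    proof (elim disjE)
      assume "p = Rec Y S \<and> q = Rec Y S'"
      with unfold[of Y S S', OF Y(1) dom S' B1(1) bis[OF Y(1)]] show ?thesis by blast
    next
      assume "p = Rec Y S' \<and> q = Rec Y S"
      with unfold[of Y S' S, OF Y(1) dom(2,1) S B1(2) bisimilar_sym[OF bis[OF Y(1)]]] show ?thesis by blast
    qed
  qed
  show ?thesis
  proof (rule bisimilarI)
    \<comment> \<open>\<open>?Q\<close> has bisimilarity at its right end only; adding it on the
      left makes the relation symmetric, and a transition is first passed through this left
      part.\<close>
    let ?T = "{(p, q). \<exists>p1. bisimilar \<Sigma> R p p1 \<and> ?Q p1 q}"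
    show "bisimulation \<Sigma> R ?T"
      unfolding bisimulation_def
    proof (intro conjI allI impI)
      show "?T \<subseteq> closed_trms \<Sigma> \<times> closed_trms \<Sigma>"
        using bisimilar_closed_trms[of \<Sigma> R] unfolding contextual_bisimilar_def by blast
      show "sym ?T"
        using bisimilar_sym[of \<Sigma> R] contextual_sym[of B, OF B_closed B_sym]
        unfolding contextual_bisimilar_def sym_def by blast
      fix p q a p' assume "(p, q) \<in> ?T \<and> proves \<Sigma> R p a p'"
      then obtain p1 where p: "bisimilar \<Sigma> R p p1" "?Q p1 q" "proves \<Sigma> R p a p'" by blast
      from p(1,3) obtain p1' where p1': "proves \<Sigma> R p1 a p1'" "bisimilar \<Sigma> R p' p1'" by (rule bisimilar_step)
      obtain q' where "proves \<Sigma> R q a q'" "?Q p1' q'"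
        by (rule contextual_bisimilar_step[OF format B_closed B_rec p(2) p1'(1)])
      with p1'(2) show "\<exists>q'. proves \<Sigma> R q a q' \<and> (p', q') \<in> ?T" by blast
    qed
    have "B (Rec X S) (Rec X S')" using \<open>X \<in> W\<close> unfolding B_def by blast
    then show "(Rec X S, Rec X S') \<in> ?T"
      using B_Q bisimilar_refl[OF format] B_closed by blast
  qed
qed

theorem mainTheorem7:
  fixes \<Sigma> :: "('f \<times> nat) set" and R :: "('f, 'v, 'a) rule set"
  assumes "\<forall>r \<in> R. tyft_tyxt_rule \<Sigma> r"
  shows "equiv (closed_trms \<Sigma>) {(p, q). bisimilar \<Sigma> R p q}
    \<and> (\<forall>f n ps qs. (f, n) \<in> \<Sigma> \<longrightarrow> length ps = n \<longrightarrow> length qs = n \<longrightarrow>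
          list_all2 (bisimilar \<Sigma> R) ps qs \<longrightarrow>
          bisimilar \<Sigma> R (Fun f ps) (Fun f qs))
    \<and> (\<forall>W X S S'. X \<in> W \<longrightarrow> dom S = W \<longrightarrow> dom S' = W \<longrightarrow>
          (\<forall>Y \<in> W. the (S Y) \<in> trms_over \<Sigma> W \<and> the (S' Y) \<in> trms_over \<Sigma> W) \<longrightarrow>
          (\<forall>Y \<in> W. \<forall>\<sigma>. (\<forall>v \<in> W. \<sigma> v \<in> closed_trms \<Sigma>) \<longrightarrow>
              bisimilar \<Sigma> R (subst (the (S Y)) \<sigma>) (subst (the (S' Y)) \<sigma>)) \<longrightarrow>
          bisimilar \<Sigma> R (Rec X S) (Rec X S'))"
proof (intro conjI allI impI)
  show "equiv (closed_trms \<Sigma>) {(p, q). bisimilar \<Sigma> R p q}" by (rule equiv_bisimilar[OF assms])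
next
  fix f n ps qs assume "(f, n) \<in> \<Sigma>" "length ps = n" "list_all2 (bisimilar \<Sigma> R) ps qs"
  then show "bisimilar \<Sigma> R (Fun f ps) (Fun f qs)" by (intro bisimilar_Fun[OF assms]) simp_all
next
  fix W X S S'
  assume "X \<in> W" "dom S = W" "dom S' = W"
    and "\<forall>Y \<in> W. the (S Y) \<in> trms_over \<Sigma> W \<and> the (S' Y) \<in> trms_over \<Sigma> W"
    and "\<forall>Y \<in> W. \<forall>\<sigma>. (\<forall>v \<in> W. \<sigma> v \<in> closed_trms \<Sigma>) \<longrightarrow>
        bisimilar \<Sigma> R (subst (the (S Y)) \<sigma>) (subst (the (S' Y)) \<sigma>)"
  then show "bisimilar \<Sigma> R (Rec X S) (Rec X S')"
    by (intro bisimilar_Rec[OF assms, of X W]) simp_all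
qed

end
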